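(* Let $X=(X_n)_{n\in\mathbb{Z}}$ be the i.i.d. increments of a skip-free to the left random walk with $\mathbb{E}[X_0]=0$, and let $[\mathbf{T},0]$ be the connected component of $0$, rooted at $0$, in the record graph of $(\mathbb{Z},X)$ (children of each vertex ordered as integers). Then $[\mathbf{T},0]$ is distributed as the ordered Eternal Galton-Watson Tree $EGWT(\pi)$ with offspring distribution $\pi$, where $\pi$ is the distribution of $X_0+1$.
   Context: **Increments.** "I.i.d. increments of a skip-free to the left random walk" means: $X=(X_n)_{n\in\mathbb{Z}}$ is i.i.d., each $X_n$ takes values in $\{-1,0,1,2,\dots\}$, $\mathbb{P}[X_0=-1]>0$ and $\mathbb{E}[X_0]<\infty$. **Record graph.** For an integer-valued sequence $x=(x_n)_{n\in\mathbb{Z}}$ the record map is $R_x(i)=\inf\{j>i:\sum_{l=i}^{j-1}x_l\ge 0\}$ if the infimum exists and $R_x(i)=i$ otherwise. The record graph of $(\mathbb{Z},x)$ is the directed graph on $\mathbb{Z}$ with edges $(i,R_x(i))$ for all $i$ with $R_x(i)\ne i$. **Family Trees.** A Family Tree is a locally finite directed tree in which each vertex has out-degree at most $1$; if there is an edge $v\to u$, then $u=F(v)$ is the parent of $v$ and $v$ a child of $u$. It is ordered if the children of each vertex are totally ordered. It is eternal if every vertex has a parent. Rooted ordered Family Trees are considered up to order- and root-preserving isomorphism, with the Borel $\sigma$-algebra of the local topology. **$EGWT(\pi)$.** Let $\pi$ be a probability distribution on $\{0,1,2,\dots\}$ with mean $1$ and $\hat\pi(k)=k\pi(k)$. $EGWT(\pi)$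 is the random rooted ordered Eternal Family Tree $[\mathbf{T},\mathbf{o}]$ such that: the ancestors $F^n(\mathbf{o})$, $n\ge1$, have offspring distribution $\hat\pi$ (one of the children of $F^n(\mathbf o)$ being $F^{n-1}(\mathbf{o})$, with $F^0(\mathbf o)=\mathbf o$); all other vertices (the root, its descendants, and the descendants of $F^n(\mathbf{o})$ which are neither $F^{n-1}(\mathbf{o})$ nor descendants of it) have offspring distribution $\pi$; all vertices reproduce independently; the order among the children of every vertex is uniform. *)

theory Defs
  imports "HOL-Probability.Probability" "HOL-Combinatorics.Multiset_Permutations"
begin

section \<open>Rooted ordered Family Trees\<close>

text \<open>
  An arc \<open>(v, u)\<close> means that \<open>u\<close> is the parent of \<open>v\<close>. The relation \<open>sib_order\<close> is
  meaningful only between vertices with the same parent.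
\<close>

record 'v rooted_graph =
  verts :: "'v set"
  arcs :: "('v \<times> 'v) set"
  sib_order :: "('v \<times> 'v) set"
  root_vertex :: 'v

definition children :: "'v rooted_graph \<Rightarrow> 'v \<Rightarrow> 'v set" where
  "children G u = {v. (v, u) \<in> arcs G}"

definition adj :: "'v rooted_graph \<Rightarrow> ('v \<times> 'v) set" where
  "adj G = arcs G \<union> (arcs G)\<inverse>"

text \<open>
  A directed graph is a tree if its underlying undirected multigraph is connected and has no
  cycle; asymmetry of the arc relation excludes cycles of length one and two.
\<close>

definition directed_tree :: "'v rooted_graph \<Rightarrow> bool" where
  "directed_tree G \<longleftrightarrow>
     root_vertex G \<in> verts G \<and> arcs G \<subseteq> verts G \<times> verts G \<and>
     (\<forall>u\<in>verts G. \<forall>v\<in>verts G. (u, v) \<in> (adj G)\<^sup>*) \<and>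
     asym (arcs G) \<and>
     \<not> (\<exists>c. 3 \<le> length c \<and> distinct c \<and>
          (\<forall>i<length c. (c ! i, c ! (Suc i mod length c)) \<in> adj G))"

text \<open>
  Since out-degrees are at most one, local finiteness amounts to finiteness of the sets of children.
\<close>

definition ordered_family_tree :: "'v rooted_graph \<Rightarrow> bool" where
  "ordered_family_tree G \<longleftrightarrow>
     directed_tree G \<and> single_valued (arcs G) \<and>
     (\<forall>u\<in>verts G. finite (children G u)) \<and>
     (\<forall>u\<in>verts G. strict_linear_order_on (children G u) (Restr (sib_order G) (children G u)))"

definition is_isomorphism :: "('v \<Rightarrow> 'w) \<Rightarrow> 'v rooted_graph \<Rightarrow> 'w rooted_graph \<Rightarrow> bool" where
  "is_isomorphism f G H \<longleftrightarrow>
     bij_betw f (verts G) (verts H) \<and> f (root_vertex G) = root_vertex H \<and>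
     (\<forall>u\<in>verts G. \<forall>v\<in>verts G. (u, v) \<in> arcs G \<longleftrightarrow> (f u, f v) \<in> arcs H) \<and>
     (\<forall>w\<in>verts G. \<forall>u\<in>verts G. \<forall>v\<in>verts G. (u, w) \<in> arcs G \<and> (v, w) \<in> arcs G \<longrightarrow>
        ((u, v) \<in> sib_order G \<longleftrightarrow> (f u, f v) \<in> sib_order H))"

definition isomorphic :: "'v rooted_graph \<Rightarrow> 'w rooted_graph \<Rightarrow> bool" where
  "isomorphic G H \<longleftrightarrow> (\<exists>f. is_isomorphism f G H)"

lemma isomorphic_refl: "isomorphic G G"
  unfolding isomorphic_def is_isomorphism_def by (intro exI[of _ id]) auto

lemma is_isomorphism_inv:
  assumes "is_isomorphism f G H" "root_vertex G \<in> verts G"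
  shows "is_isomorphism (inv_into (verts G) f) H G"
proof -
  let ?g = "inv_into (verts G) f"
  have b: "bij_betw f (verts G) (verts H)" using assms(1) by (simp add: is_isomorphism_def)
  have g: "?g y \<in> verts G" "f (?g y) = y" if "y \<in> verts H" for y
    using b that by (auto simp: bij_betw_def inv_into_into f_inv_into_f)
  have r: "?g (root_vertex H) = root_vertex G"
    using assms bij_betw_inv_into_left[OF b assms(2)] by (simp add: is_isomorphism_def)
  have a: "(?g u, ?g v) \<in> arcs G \<longleftrightarrow> (u, v) \<in> arcs H" if "u \<in> verts H" "v \<in> verts H" for u v
    using assms(1) g[OF that(1)] g[OF that(2)] by (simp add: is_isomorphism_def)
  have o: "(?g u, ?g v) \<in> sib_order G \<longleftrightarrow> (u, v) \<in> sib_order H"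
    if "u \<in> verts H" "v \<in> verts H" "w \<in> verts H" "(u, w) \<in> arcs H" "(v, w) \<in> arcs H" for u v w
  proof -
    have "\<forall>w\<in>verts G. \<forall>u\<in>verts G. \<forall>v\<in>verts G. (u, w) \<in> arcs G \<and> (v, w) \<in> arcs G \<longrightarrow>
        ((u, v) \<in> sib_order G \<longleftrightarrow> (f u, f v) \<in> sib_order H)"
      using assms(1) by (simp add: is_isomorphism_def)
    from this[rule_format, of "?g w" "?g u" "?g v"] show ?thesis using that g a by simp
  qed
  show ?thesis
    unfolding is_isomorphism_def
    by (intro conjI ballI impI bij_betw_inv_into[OF b] r a[symmetric] o[symmetric]; blast)
qed

lemma isomorphic_sym:
  "isomorphic G H \<Longrightarrow> root_vertex G \<in> verts G \<Longrightarrow> isomorphic H G"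
  using is_isomorphism_inv unfolding isomorphic_def by blast

lemma isomorphic_trans:
  assumes "isomorphic G H" "isomorphic H K"
  shows "isomorphic G K"
proof -
  obtain f g where f: "is_isomorphism f G H" and g: "is_isomorphism g H K"
    using assms by (auto simp: isomorphic_def)
  have fv: "f u \<in> verts H" if "u \<in> verts G" for u
    using f that by (auto simp: is_isomorphism_def bij_betw_def)
  have "bij_betw (g \<circ> f) (verts G) (verts K)"
    using f g by (auto simp: is_isomorphism_def intro: bij_betw_trans)
  then have "is_isomorphism (g \<circ> f) G K"
    using f g fv unfolding is_isomorphism_def by (simp, metis)
  then show ?thesis by (auto simp: isomorphic_def)
qed

lemma family_tree_root: "ordered_family_tree G \<Longrightarrow> root_vertex G \<in> verts G"
  by (simp add: ordered_family_tree_def directed_tree_def)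

lemma family_tree_arcs: "ordered_family_tree G \<Longrightarrow> (u, v) \<in> arcs G \<Longrightarrow> u \<in> verts G \<and> v \<in> verts G"
  by (auto simp: ordered_family_tree_def directed_tree_def)


section \<open>Neighbourhoods of the root\<close>

definition ball_verts :: "nat \<Rightarrow> 'v rooted_graph \<Rightarrow> 'v set" where
  "ball_verts r G = {v \<in> verts G. \<exists>k\<le>r. (root_vertex G, v) \<in> adj G ^^ k}"

definition root_ball :: "nat \<Rightarrow> 'v rooted_graph \<Rightarrow> 'v rooted_graph" where
  "root_ball r G = G\<lparr>verts := ball_verts r G, arcs := Restr (arcs G) (ball_verts r G)\<rparr>"

lemma isomorphism_relpow:
  assumes "ordered_family_tree G" "is_isomorphism f G H" "(root_vertex G, v) \<in> adj G ^^ k"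
  shows "v \<in> verts G \<and> (root_vertex H, f v) \<in> adj H ^^ k"
  using assms(3)
proof (induction k arbitrary: v)
  case 0
  then show ?case using assms family_tree_root by (auto simp: is_isomorphism_def)
next
  case (Suc k)
  then obtain u where u: "(root_vertex G, u) \<in> adj G ^^ k" "(u, v) \<in> adj G" by auto
  then have *: "u \<in> verts G" "(root_vertex H, f u) \<in> adj H ^^ k" using Suc by auto
  have "v \<in> verts G" using u(2) family_tree_arcs[OF assms(1)] by (auto simp: adj_def)
  moreover have "(f u, f v) \<in> adj H"
    using u(2) * \<open>v \<in> verts G\<close> assms(2) by (auto simp: adj_def is_isomorphism_def)
  ultimately show ?case using *(2) by auto
qed

lemma isomorphic_root_ball:
  assumes "ordered_family_tree G" "ordered_family_tree H" "isomorphic G H"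
  shows "isomorphic (root_ball r G) (root_ball r H)"
proof -
  obtain f where f: "is_isomorphism f G H" using assms by (auto simp: isomorphic_def)
  define g where "g = inv_into (verts G) f"
  have g: "is_isomorphism g H G"
    unfolding g_def using is_isomorphism_inv f family_tree_root assms(1) by blast
  have b: "bij_betw f (verts G) (verts H)" using f by (simp add: is_isomorphism_def)
  have 1: "f v \<in> ball_verts r H" if "v \<in> ball_verts r G" for v
    using that isomorphism_relpow[OF assms(1) f] bij_betwE[OF b] unfolding ball_verts_def by blast
  have 2: "v \<in> f ` ball_verts r G" if "v \<in> ball_verts r H" for v
  proof -
    have "g v \<in> ball_verts r G"
      using that isomorphism_relpow[OF assms(2) g] bij_betwE g
      unfolding ball_verts_def is_isomorphism_def by blast
    moreover have "f (g v) = v"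
      using that b unfolding g_def ball_verts_def by (simp add: bij_betw_inv_into_right)
    ultimately show ?thesis by force
  qed
  have sub: "ball_verts r G \<subseteq> verts G" by (auto simp: ball_verts_def)
  have "bij_betw f (ball_verts r G) (ball_verts r H)"
    using 1 2 b sub unfolding bij_betw_def by (meson image_subsetI inj_on_subset subsetI subset_antisym)
  then have "is_isomorphism f (root_ball r G) (root_ball r H)"
    using f sub 1 unfolding is_isomorphism_def root_ball_def
    by (simp add: subset_iff) meson
  then show ?thesis by (auto simp: isomorphic_def)
qed


section \<open>The space of isomorphism classes\<close>

text \<open>
  A Family Tree is countable, so every isomorphism class has a representative
  whose vertices are natural numbers.
\<close>

lemma ordered_family_tree_singleton:
  "ordered_family_tree \<lparr>verts = {v}, arcs = {}, sib_order = {}, root_vertex = v\<rparr>"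
proof -
  have "\<not> (\<exists>c::'a list. 3 \<le> length c \<and> (\<forall>i<length c. False))"
    by (metis less_le_trans zero_less_numeral)
  then show ?thesis
    unfolding ordered_family_tree_def directed_tree_def
    by (auto simp: adj_def children_def strict_linear_order_on_def single_valued_def
        trans_def irrefl_def total_on_def)
qed

definition same_tree :: "nat rooted_graph \<Rightarrow> nat rooted_graph \<Rightarrow> bool" where
  "same_tree G H \<longleftrightarrow> ordered_family_tree G \<and> ordered_family_tree H \<and> isomorphic G H"

lemma part_equivp_same_tree: "part_equivp same_tree"
proof (rule part_equivpI)
  have "same_tree \<lparr>verts = {0}, arcs = {}, sib_order = {}, root_vertex = 0\<rparr>
      \<lparr>verts = {0}, arcs = {}, sib_order = {}, root_vertex = 0\<rparr>"
    by (simp add: same_tree_def ordered_family_tree_singleton isomorphic_refl)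
  then show "\<exists>G. same_tree G G" by (rule exI)
  show "symp same_tree"
    by (rule sympI) (simp add: same_tree_def isomorphic_sym family_tree_root)
  show "transp same_tree"
  proof (rule transpI)
    fix G H K assume "same_tree G H" "same_tree H K"
    then show "same_tree G K"
      unfolding same_tree_def using isomorphic_trans[of G H K] by simp
  qed
qed

quotient_type rooted_tree = "nat rooted_graph" / partial: same_tree
  by (rule part_equivp_same_tree)

definition relabel :: "('v \<Rightarrow> 'w) \<Rightarrow> 'v rooted_graph \<Rightarrow> 'w rooted_graph" where
  "relabel f G = \<lparr>verts = f ` verts G, arcs = map_prod f f ` arcs G,
     sib_order = map_prod f f ` sib_order G, root_vertex = f (root_vertex G)\<rparr>"

definition iso_class :: "'v::countable rooted_graph \<Rightarrow> rooted_tree" where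
  "iso_class G = abs_rooted_tree (relabel to_nat G)"

lemma map_prod_mem_iff: "inj f \<Longrightarrow> (f u, f v) \<in> map_prod f f ` A \<longleftrightarrow> (u, v) \<in> A"
  by (auto dest: injD)

lemma map_prod_memD: "(x, y) \<in> map_prod f f ` A \<Longrightarrow> \<exists>a b. x = f a \<and> y = f b \<and> (a, b) \<in> A"
  by auto

lemma isomorphic_relabel: "inj f \<Longrightarrow> isomorphic G (relabel f G)"
  unfolding isomorphic_def
  by (intro exI[of _ f])
    (auto simp: is_isomorphism_def relabel_def map_prod_mem_iff bij_betw_def inj_on_def dest: injD)

lemma ordered_family_tree_relabel:
  assumes G: "ordered_family_tree G" and f: "inj f"
  shows "ordered_family_tree (relabel f G)"
proof -
  let ?H = "relabel f G"
  have adj: "adj ?H = map_prod f f ` adj G" by (auto simp: adj_def relabel_def)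
  have ch: "children ?H (f u) = f ` children G u" for u
    using f by (force simp: children_def relabel_def dest: injD)
  have conn: "(f u, f v) \<in> (adj ?H)\<^sup>*" if "(u, v) \<in> (adj G)\<^sup>*" for u v
    using that
  proof induction
    case (step y z)
    then have "(f y, f z) \<in> adj ?H" by (force simp: adj)
    then show ?case using step by auto
  qed auto
  have cyc: "\<exists>c. 3 \<le> length c \<and> distinct c \<and>
      (\<forall>i<length c. (c ! i, c ! (Suc i mod length c)) \<in> adj G)"
    if c: "3 \<le> length c" "distinct c"
      "\<forall>i<length c. (c ! i, c ! (Suc i mod length c)) \<in> adj ?H" for c
  proof -
    have "set c \<subseteq> range f"
    proof
      fix x assume "x \<in> set c"
      then obtain i where "i < length c" "x = c ! i" by (auto simp: in_set_conv_nth)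
      then have "(x, c ! (Suc i mod length c)) \<in> map_prod f f ` adj G" using c adj by auto
      then show "x \<in> range f" by auto
    qed
    then obtain d where d: "c = map f d" by (metis ex_map_conv rangeE subsetD)
    have "(d ! i, d ! (Suc i mod length d)) \<in> adj G" if i: "i < length d" for i
    proof -
      have "Suc i mod length d < length d" using i by (intro mod_less_divisor) auto
      then have "(f (d ! i), f (d ! (Suc i mod length d))) \<in> map_prod f f ` adj G"
        using c(3) i d adj by (metis length_map nth_map)
      then show ?thesis by (simp only: map_prod_mem_iff[OF f])
    qed
    moreover have "3 \<le> length d" "distinct d" using c d by (simp_all add: distinct_map)
    ultimately show ?thesis by blast
  qed
  have "asym (arcs G)" using G by (simp add: ordered_family_tree_def directed_tree_def)
  then have "asym (arcs ?H)"
    using f by (auto simp: relabel_def asym_on_def dest: injD)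
  moreover have "single_valued (arcs ?H)"
  proof (rule single_valuedI)
    fix x y z assume xy: "(x, y) \<in> arcs ?H" and xz: "(x, z) \<in> arcs ?H"
    obtain a b where 1: "x = f a" "y = f b" "(a, b) \<in> arcs G"
      using xy map_prod_memD[of x y f] by (auto simp: relabel_def)
    obtain a' c where 2: "x = f a'" "z = f c" "(a', c) \<in> arcs G"
      using xz map_prod_memD[of x z f] by (auto simp: relabel_def)
    note * = 1 2
    then have "a = a'" using f by (simp add: inj_eq)
    then have "b = c" using * G by (meson ordered_family_tree_def single_valuedD)
    then show "y = z" using * by simp
  qed
  moreover have "strict_linear_order_on (children ?H (f u))
      (Restr (sib_order ?H) (children ?H (f u)))" if u: "u \<in> verts G" for u
  proof -
    let ?C = "children G u"
    have r: "Restr (sib_order ?H) (f ` ?C) = map_prod f f ` Restr (sib_order G) ?C"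
      using f by (auto simp: relabel_def dest: injD)
    have s: "strict_linear_order_on ?C (Restr (sib_order G) ?C)"
      using G u by (simp add: ordered_family_tree_def)
    have "trans (map_prod f f ` Restr (sib_order G) ?C)"
    proof (rule transI)
      fix x y z assume "(x, y) \<in> map_prod f f ` Restr (sib_order G) ?C"
        "(y, z) \<in> map_prod f f ` Restr (sib_order G) ?C"
      then obtain a b b' c where *: "x = f a" "y = f b" "y = f b'" "z = f c"
        "(a, b) \<in> Restr (sib_order G) ?C" "(b', c) \<in> Restr (sib_order G) ?C" by blast
      then have "b = b'" using f by (auto dest: injD)
      then have "(a, c) \<in> Restr (sib_order G) ?C"
        using * s unfolding strict_linear_order_on_def by (meson transD)
      then show "(x, z) \<in> map_prod f f ` Restr (sib_order G) ?C" using * by force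
    qed
    moreover have "irrefl (map_prod f f ` Restr (sib_order G) ?C)"
      using s f by (auto simp: strict_linear_order_on_def irrefl_def dest: injD)
    moreover have "total_on (f ` ?C) (map_prod f f ` Restr (sib_order G) ?C)"
    proof (rule total_onI)
      fix x y assume "x \<in> f ` ?C" "y \<in> f ` ?C" "x \<noteq> y"
      then obtain a b where *: "x = f a" "y = f b" "a \<in> ?C" "b \<in> ?C" "a \<noteq> b" by auto
      then have "(a, b) \<in> Restr (sib_order G) ?C \<or> (b, a) \<in> Restr (sib_order G) ?C"
        using s by (auto simp: strict_linear_order_on_def total_on_def)
      then show "(x, y) \<in> map_prod f f ` Restr (sib_order G) ?C \<or>
          (y, x) \<in> map_prod f f ` Restr (sib_order G) ?C" using * by force
    qed
    ultimately show ?thesis unfolding ch r strict_linear_order_on_def by blast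
  qed
  moreover have "\<not> (\<exists>c. 3 \<le> length c \<and> distinct c \<and>
      (\<forall>i<length c. (c ! i, c ! (Suc i mod length c)) \<in> adj ?H))"
    using G cyc unfolding ordered_family_tree_def directed_tree_def by meson
  moreover have v: "verts ?H = f ` verts G" by (simp add: relabel_def)
  moreover have "root_vertex ?H \<in> verts ?H"
    using family_tree_root[OF G] by (simp add: relabel_def)
  moreover have "arcs ?H \<subseteq> verts ?H \<times> verts ?H"
    using family_tree_arcs[OF G] by (auto simp: relabel_def)
  moreover have "\<forall>u\<in>verts ?H. \<forall>w\<in>verts ?H. (u, w) \<in> (adj ?H)\<^sup>*"
    using G conn unfolding v ordered_family_tree_def directed_tree_def by simp
  moreover have "\<forall>u\<in>verts ?H. finite (children ?H u)"
    using G ch unfolding v ordered_family_tree_def by simp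
  ultimately show ?thesis
    unfolding ordered_family_tree_def directed_tree_def v by simp
qed

lemma iso_class_eq_iff:
  fixes G :: "'v::countable rooted_graph" and H :: "'w::countable rooted_graph"
  assumes "ordered_family_tree G" "ordered_family_tree H"
  shows "iso_class G = iso_class H \<longleftrightarrow> isomorphic G H"
proof -
  let ?G = "relabel to_nat G :: nat rooted_graph" and ?H = "relabel to_nat H :: nat rooted_graph"
  have "ordered_family_tree ?G" "ordered_family_tree ?H"
    using assms by (auto intro: ordered_family_tree_relabel)
  then have "iso_class G = iso_class H \<longleftrightarrow> isomorphic ?G ?H"
    unfolding iso_class_def using Quotient_rel[OF Quotient_rooted_tree, of ?G ?H]
    by (simp add: same_tree_def isomorphic_refl)
  moreover have G: "isomorphic G ?G" and H: "isomorphic H ?H" by (auto intro: isomorphic_relabel)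
  moreover have G': "isomorphic ?G G" and H': "isomorphic ?H H"
    using G H assms[THEN family_tree_root] by (auto intro: isomorphic_sym)
  moreover have "isomorphic ?G ?H" if "isomorphic G H"
    by (rule isomorphic_trans[OF isomorphic_trans[OF G' that] H])
  moreover have "isomorphic G H" if "isomorphic ?G ?H"
    by (rule isomorphic_trans[OF isomorphic_trans[OF G that] H'])
  ultimately show ?thesis by argo
qed

lift_definition agree_upto :: "nat \<Rightarrow> rooted_tree \<Rightarrow> rooted_tree \<Rightarrow> bool" is
  "\<lambda>r G H. isomorphic (root_ball r G) (root_ball r H)"
proof -
  fix r and G G' H H' :: "nat rooted_graph"
  assume "same_tree G G'" "same_tree H H'"
  then have G: "ordered_family_tree G \<and> ordered_family_tree G' \<and> isomorphic G G'"
    and H: "ordered_family_tree H \<and> ordered_family_tree H' \<and> isomorphic H H'"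
    by (simp_all add: same_tree_def)
  have rt: "root_vertex (root_ball r K) \<in> verts (root_ball r K)"
    if "ordered_family_tree K" for K :: "nat rooted_graph"
    using family_tree_root[OF that] by (auto simp: root_ball_def ball_verts_def intro!: exI[of _ 0])
  have "isomorphic (root_ball r G) (root_ball r G')" "isomorphic (root_ball r H) (root_ball r H')"
    using G H isomorphic_root_ball by auto
  then show "isomorphic (root_ball r G) (root_ball r H) = isomorphic (root_ball r G') (root_ball r H')"
    using G H by (meson isomorphic_sym isomorphic_trans rt)
qed

text \<open>
  The local topology: two trees are close if their balls of a large radius around the roots are
  isomorphic as rooted ordered graphs.
\<close>

instantiation rooted_tree :: topological_space
begin

definition open_rooted_tree :: "rooted_tree set \<Rightarrow> bool" where
  "open_rooted_tree = generate_topology (range (\<lambda>(r, T). {T'. agree_upto r T T'}))"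

instance
  by intro_classes (auto simp: open_rooted_tree_def intro: generate_topology.intros)

end


section \<open>Connected components of parent graphs\<close>

definition component :: "('v \<times> 'v) set \<Rightarrow> ('v \<times> 'v) set \<Rightarrow> 'v \<Rightarrow> 'v rooted_graph" where
  "component E L v = (let C = {w. (v, w) \<in> (E \<union> E\<inverse>)\<^sup>*} in
     \<lparr>verts = C, arcs = Restr E C, sib_order = L, root_vertex = v\<rparr>)"

lemma ordered_family_tree_component:
  fixes h :: "'v \<Rightarrow> int"
  assumes sv: "single_valued E"
    and h: "\<And>u v. (u, v) \<in> E \<Longrightarrow> h u < h v"
    and fin: "\<And>u. finite {v. (v, u) \<in> E}"
    and lin: "\<And>u. strict_linear_order_on {v. (v, u) \<in> E} (Restr L {v. (v, u) \<in> E})"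
  shows "ordered_family_tree (component E L r)"
proof -
  define C where "C = {w. (r, w) \<in> (E \<union> E\<inverse>)\<^sup>*}"
  define G where "G = \<lparr>verts = C, arcs = Restr E C, sib_order = L, root_vertex = r\<rparr>"
  have G: "component E L r = G" by (simp add: G_def C_def component_def Let_def)
  have C: "w \<in> C \<longleftrightarrow> v \<in> C" if "(v, w) \<in> E" for v w
    using that unfolding C_def mem_Collect_eq
    by (meson UnI1 UnI2 converseI rtrancl.rtrancl_into_rtrancl)
  have adj: "adj G = Restr (E \<union> E\<inverse>) C" by (auto simp: adj_def G_def)
  have from_root: "(r, w) \<in> (adj G)\<^sup>*" if "(r, w) \<in> (E \<union> E\<inverse>)\<^sup>*" for w
    using that
  proof induction
    case (step y z)
    have "y \<in> C" "z \<in> C"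
      unfolding C_def mem_Collect_eq
      using step.hyps(1) rtrancl.rtrancl_into_rtrancl[OF step.hyps] by blast+
    then have "(y, z) \<in> adj G" using step.hyps(2) unfolding adj by simp
    then show ?case using step.IH by (rule rtrancl.rtrancl_into_rtrancl[rotated])
  qed auto
  have symadj: "sym ((adj G)\<^sup>*)" by (intro sym_rtrancl) (auto simp: adj_def sym_def)
  have conn: "(u, v) \<in> (adj G)\<^sup>*" if "u \<in> C" "v \<in> C" for u v
    using that from_root symadj unfolding C_def by (metis mem_Collect_eq rtrancl_trans symD)
  have asym: "asym (arcs G)" 
    by (rule asymI) (auto simp: G_def dest!: h)
  have nocyc: False if c: "3 \<le> length c" "distinct c"
      "\<forall>i<length c. (c ! i, c ! (Suc i mod length c)) \<in> adj G" for c
  proof -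
    let ?n = "length c"
    have n: "?n \<noteq> 0" "2 < ?n" using c(1) by auto
    obtain i where i: "i < ?n" "\<And>j. j < ?n \<Longrightarrow> h (c ! i) \<le> h (c ! j)"
      using ex_has_least_nat[of "\<lambda>i. i < ?n" 0 "\<lambda>i. nat (h (c ! i) - Min (h ` set c))"] n
        Min_le[of "h ` set c"]
      by (smt (verit) List.finite_set finite_imageI imageI nat_0_iff nat_le_eq_zle nth_mem gr0I)
    have up: "(c ! i, c ! j) \<in> E" if "(c ! i, c ! j) \<in> adj G" "j < ?n" for j
      using that i(2)[of j] h[of "c ! j" "c ! i"] unfolding adj by auto
    define j where "j = Suc i mod ?n"
    define k where "k = (if i = 0 then ?n - 1 else i - 1)"
    have j: "j < ?n" "j = (if Suc i = ?n then 0 else Suc i)"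
      using i(1) n by (auto simp: j_def mod_Suc)
    have k: "k < ?n" "Suc k mod ?n = i" using i(1) n by (auto simp: k_def)
    have "(c ! i, c ! j) \<in> E" using up j c(3) i(1) unfolding j_def by blast
    moreover have "(c ! k, c ! i) \<in> adj G" using c(3) k by metis
    then have "(c ! i, c ! k) \<in> E" using up k by (auto simp: adj_def)
    ultimately have "c ! j = c ! k" using sv by (auto simp: single_valued_def)
    then have "j = k" using c(2) j k by (simp add: nth_eq_iff_index_eq)
    then show False using j(2) i(1) n by (auto simp: k_def split: if_splits)
  qed
  have ch: "children G u = {v. (v, u) \<in> E}" if "u \<in> C" for u
    using that C by (auto simp: children_def G_def)
  have "r \<in> C" by (simp add: C_def)
  have "\<not> (\<exists>c. 3 \<le> length c \<and> distinct c \<and>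
      (\<forall>i<length c. (c ! i, c ! (Suc i mod length c)) \<in> adj G))"
    using nocyc by meson
  moreover have "verts G = C" "root_vertex G = r" "arcs G \<subseteq> C \<times> C" by (auto simp: G_def)
  ultimately have "directed_tree G"
    unfolding directed_tree_def using asym conn \<open>r \<in> C\<close> by simp
  then show ?thesis
    unfolding G ordered_family_tree_def using ch fin lin sv
    by (auto simp: G_def single_valued_def)
qed


section \<open>The record graph\<close>

definition record_map :: "(int \<Rightarrow> int) \<Rightarrow> int \<Rightarrow> int" where
  "record_map x i =
     (let J = {j. i < j \<and> 0 \<le> (\<Sum>l=i..<j. x l)} in if J = {} then i else Inf J)"

definition record_graph :: "(int \<Rightarrow> int) \<Rightarrow> (int \<times> int) set" where
  "record_graph x = {(i, record_map x i) | i. record_map x i \<noteq> i}"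

definition record_tree :: "(int \<Rightarrow> int) \<Rightarrow> int rooted_graph" where
  "record_tree x = component (record_graph x) {(i, j). i < j} 0"

lemma record_graph_iff:
  "(i, j) \<in> record_graph x \<longleftrightarrow>
     i < j \<and> 0 \<le> (\<Sum>l=i..<j. x l) \<and> (\<forall>k. i < k \<and> k < j \<longrightarrow> (\<Sum>l=i..<k. x l) < 0)"
proof -
  define J where "J = {j. i < j \<and> 0 \<le> (\<Sum>l=i..<j. x l)}"
  have bdd: "bdd_below J" by (intro bdd_belowI[of _ i]) (auto simp: J_def)
  have R: "record_map x i = (if J = {} then i else Inf J)"
    unfolding record_map_def J_def Let_def by (rule refl)
  have Inf: "Inf J \<in> J" if ne: "J \<noteq> {}"
  proof -
    obtain m where m: "m \<in> J" using ne by blast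
    let ?K = "J \<inter> {i..m}"
    have "finite ?K" "?K \<noteq> {}" using m by (auto simp: J_def)
    then have K: "Min ?K \<in> ?K" by (rule Min_in)
    have le: "Min ?K \<le> k" if "k \<in> ?K" for k by (rule Min_le[OF \<open>finite ?K\<close> that])
    have "Min ?K \<le> k" if k: "k \<in> J" for k
    proof (cases "k \<le> m")
      case True
      then show ?thesis using k by (intro le) (simp add: J_def)
    next
      case False
      have "m \<in> ?K" using m by (simp add: J_def)
      then show ?thesis using le[of m] False by linarith
    qed
    then have "Inf J = Min ?K" using K by (intro cInf_eq_minimum) auto
    then show ?thesis using K by auto
  qed
  show ?thesis
  proof
    assume "(i, j) \<in> record_graph x"
    then have *: "J \<noteq> {}" "j = Inf J" by (auto simp: record_graph_def R split: if_splits)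
    then have "j \<in> J" using Inf by simp
    moreover have "k \<notin> J" if "k < j" for k
      using that * bdd by (meson cInf_lower not_less)
    ultimately show "i < j \<and> 0 \<le> (\<Sum>l=i..<j. x l) \<and>
        (\<forall>k. i < k \<and> k < j \<longrightarrow> (\<Sum>l=i..<k. x l) < 0)"
      by (force simp: J_def)
  next
    assume *: "i < j \<and> 0 \<le> (\<Sum>l=i..<j. x l) \<and>
      (\<forall>k. i < k \<and> k < j \<longrightarrow> (\<Sum>l=i..<k. x l) < 0)"
    then have "j \<in> J" by (simp add: J_def)
    moreover have "j \<le> k" if "k \<in> J" for k
      using that * unfolding J_def by (metis mem_Collect_eq not_less)
    ultimately have "J \<noteq> {}" "Inf J = j" by (auto intro!: cInf_eq_minimum)
    then show "(i, j) \<in> record_graph x" using * by (auto simp: record_graph_def R)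
  qed
qed

lemma ordered_family_tree_record_tree: "ordered_family_tree (record_tree x)"
  unfolding record_tree_def
proof (rule ordered_family_tree_component[where h = "\<lambda>i. i"])
  show "single_valued (record_graph x)" by (auto simp: single_valued_def record_graph_def)
  show "u < v" if "(u, v) \<in> record_graph x" for u v using that by (simp add: record_graph_iff)
  show "strict_linear_order_on {v. (v, u) \<in> record_graph x}
      (Restr {(i, j). i < j} {v. (v, u) \<in> record_graph x})" for u
    by (auto simp: strict_linear_order_on_def trans_def irrefl_def total_on_def)
  show "finite {v. (v, u) \<in> record_graph x}" for u
  proof (cases "{v. (v, u) \<in> record_graph x} = {}")
    case False
    then obtain v where v: "(v, u) \<in> record_graph x" by auto
    define T where "T j = (\<Sum>l=j..<u. x l)" for j
    have split: "T j = (\<Sum>l=j..<k. x l) + T k" if "j \<le> k" "k \<le> u" for j k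
      unfolding T_def using that by (subst sum.union_disjoint[symmetric]) (auto intro!: sum.cong)
    have mono: "T j < T k" if "(j, u) \<in> record_graph x" "j < k" "k < u" for j k
      using split[of j k] that by (auto simp: record_graph_iff)
    let ?A = "{j. (j, u) \<in> record_graph x \<and> j < v}"
    have "v < u" using v by (simp add: record_graph_iff)
    have "T ` ?A \<subseteq> {0..T v}"
    proof (rule image_subsetI)
      fix j assume "j \<in> ?A"
      then have "0 \<le> T j" "T j < T v" using mono[of j v] \<open>v < u\<close> by (auto simp: T_def record_graph_iff)
      then show "T j \<in> {0..T v}" by simp
    qed
    moreover have "inj_on T ?A"
    proof (rule linorder_inj_onI)
      fix j k assume "j < k" "j \<in> ?A" "k \<in> ?A"
      then show "T j \<noteq> T k" using mono[of j k] \<open>v < u\<close> by auto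
    qed auto
    ultimately have "finite ?A" by (meson finite_atLeastAtMost_int finite_imageD finite_subset)
    moreover have "{v. (v, u) \<in> record_graph x} \<subseteq> ?A \<union> {v..<u}"
      by (auto simp: record_graph_iff)
    ultimately show ?thesis by (meson finite_UnI finite_atLeastLessThan_int finite_subset)
  qed simp
qed


section \<open>The Eternal Galton--Watson Tree\<close>

text \<open>
  Vertices are labelled by pairs: \<open>(n, [])\<close> is the \<open>n\<close>-th ancestor of the root \<open>(0, [])\<close>.
  The children of a vertex are numbered from 0, independently of their order; child number 0 of
  the ancestor \<open>(Suc n, [])\<close> is \<open>(n, [])\<close>, and child number \<open>i\<close> of \<open>(n, w)\<close> is
  \<open>(n, i # w)\<close> in all other cases.
\<close>

type_synonym label = "nat \<times> nat list"

fun child :: "label \<Rightarrow> nat \<Rightarrow> label" where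
  "child (Suc n, []) 0 = (n, [])"
| "child (n, w) i = (n, i # w)"

text \<open>
  The size-biased distribution; this is a distribution when \<open>p\<close> has mean 1.
\<close>

definition size_biased :: "nat pmf \<Rightarrow> nat pmf" where
  "size_biased p = embed_pmf (\<lambda>k. real k * pmf p k)"

text \<open>
  The reproduction of a vertex is described by the list of its children in their order: the number
  \<open>k\<close> of children has law \<open>p\<close>, and given \<open>k\<close> the list is a uniform arrangement of
  \<open>0, \<dots>, k - 1\<close>.
\<close>

definition reproduction :: "nat pmf \<Rightarrow> nat list pmf" where
  "reproduction p = do {k \<leftarrow> p; pmf_of_set (permutations_of_set {..<k})}"

definition reproduction_at :: "nat pmf \<Rightarrow> label \<Rightarrow> nat list pmf" where
  "reproduction_at p v = reproduction (if 0 < fst v \<and> snd v = [] then size_biased p else p)"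

text \<open>
  For distinct \<open>i\<close> and \<open>j\<close> in the list \<open>xs\<close>, \<open>precedes xs i j\<close> states that \<open>i\<close> comes
  before \<open>j\<close>. Lists with repetitions have probability zero.
\<close>

definition precedes :: "nat list \<Rightarrow> nat \<Rightarrow> nat \<Rightarrow> bool" where
  "precedes xs i j \<longleftrightarrow> i \<in> set (takeWhile (\<lambda>k. k \<noteq> j) xs)"

definition galton_watson_tree :: "(label \<Rightarrow> nat list) \<Rightarrow> label rooted_graph" where
  "galton_watson_tree \<omega> =
     component {(child v i, v) | v i. i \<in> set (\<omega> v)}
       {(child v i, child v j) | v i j. precedes (\<omega> v) i j} (0, [])"

definition EGWT :: "nat pmf \<Rightarrow> rooted_tree measure" where
  "EGWT p = distr (PiM UNIV (\<lambda>v. measure_pmf (reproduction_at p v))) borel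
     (\<lambda>\<omega>. iso_class (galton_watson_tree \<omega>))"

lemma child_cases:
  "(\<exists>n. v = (Suc n, []) \<and> i = 0 \<and> child v i = (n, [])) \<or>
   \<not> (0 < fst v \<and> snd v = [] \<and> i = 0) \<and> child v i = (fst v, i # snd v)"
  by (cases "(v, i)" rule: child.cases) auto

lemma child_inject: "child v i = child w j \<longleftrightarrow> v = w \<and> i = j"
  by (cases "(v, i)" rule: child.cases; cases "(w, j)" rule: child.cases) auto

lemma precedes_Cons: "precedes (x # xs) i j \<longleftrightarrow> x \<noteq> j \<and> (i = x \<or> precedes xs i j)"
  by (cases "x = j") (simp_all add: precedes_def)

lemma precedes_irrefl: "\<not> precedes xs i i"
  unfolding precedes_def by (metis set_takeWhileD)

lemma precedes_trans: "precedes xs i j \<Longrightarrow> precedes xs j k \<Longrightarrow> precedes xs i k"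
proof (induction xs)
  case (Cons x xs)
  then show ?case by (auto simp: precedes_Cons)
qed (simp add: precedes_def)

lemma precedes_total: "i \<in> set xs \<Longrightarrow> j \<in> set xs \<Longrightarrow> i \<noteq> j \<Longrightarrow> precedes xs i j \<or> precedes xs j i"
proof (induction xs)
  case (Cons x xs)
  then show ?case by (auto simp: precedes_Cons)
qed simp

lemma strict_linear_order_on_image:
  assumes L: "\<And>i j. (f i, f j) \<in> L \<longleftrightarrow> P i j"
    and irr: "\<And>i. \<not> P i i" and tr: "\<And>i j k. P i j \<Longrightarrow> P j k \<Longrightarrow> P i k"
    and tot: "\<And>i j. i \<in> S \<Longrightarrow> j \<in> S \<Longrightarrow> i \<noteq> j \<Longrightarrow> P i j \<or> P j i"
  shows "strict_linear_order_on (f ` S) (Restr L (f ` S))"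
  unfolding strict_linear_order_on_def
proof (intro conjI transI irreflI total_onI)
  fix a b c assume ab: "(a, b) \<in> Restr L (f ` S)" and bc: "(b, c) \<in> Restr L (f ` S)"
  then obtain i j k where *: "a = f i" "b = f j" "c = f k" "i \<in> S" "k \<in> S" by auto
  then have "P i k" using ab bc L tr[of i j k] by simp
  then show "(a, c) \<in> Restr L (f ` S)" using * L by simp
next
  fix a show "(a, a) \<notin> Restr L (f ` S)" using L irr by auto
next
  fix a b assume "a \<in> f ` S" "b \<in> f ` S" "a \<noteq> b"
  then obtain i j where *: "a = f i" "b = f j" "i \<in> S" "j \<in> S" "i \<noteq> j" by auto
  then show "(a, b) \<in> Restr L (f ` S) \<or> (b, a) \<in> Restr L (f ` S)" using L tot[of i j] by simp
qed

lemma ordered_family_tree_galton_watson_tree: "ordered_family_tree (galton_watson_tree \<omega>)"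
  unfolding galton_watson_tree_def
proof (rule ordered_family_tree_component[where h = "\<lambda>v. int (fst v) - int (length (snd v))"])
  let ?E = "{(child v i, v) | v i. i \<in> set (\<omega> v)}"
  let ?L = "{(child v i, child v j) | v i j. precedes (\<omega> v) i j}"
  show "single_valued ?E" by (auto simp: single_valued_def child_inject)
  show "int (fst u) - int (length (snd u)) < int (fst v) - int (length (snd v))"
    if uv: "(u, v) \<in> ?E" for u v
  proof -
    obtain i where "u = child v i" using uv by blast
    then show ?thesis using child_cases[of v i] by auto
  qed
  have ch: "{v. (v, u) \<in> ?E} = child u ` set (\<omega> u)" for u by blast
  show "finite {v. (v, u) \<in> ?E}" for u unfolding ch by simp
  show "strict_linear_order_on {v. (v, u) \<in> ?E} (Restr ?L {v. (v, u) \<in> ?E})" for u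
  proof -
    have L: "(child u i, child u j) \<in> ?L \<longleftrightarrow> precedes (\<omega> u) i j" for i j
      unfolding mem_Collect_eq prod.inject child_inject by blast
    show ?thesis
      unfolding ch using L precedes_irrefl precedes_trans precedes_total
      by (rule strict_linear_order_on_image)
  qed
qed


section \<open>Skip-free increments\<close>

definition skip_free_increments :: "'a measure \<Rightarrow> (int \<Rightarrow> 'a \<Rightarrow> int) \<Rightarrow> bool" where
  "skip_free_increments M X \<longleftrightarrow>
     prob_space M \<and>
     prob_space.indep_vars M (\<lambda>_. count_space UNIV) X UNIV \<and>
     (\<forall>n. distr M (count_space UNIV) (X n) = distr M (count_space UNIV) (X 0)) \<and>
     (\<forall>n. AE \<omega> in M. - 1 \<le> X n \<omega>) \<and>
     0 < measure M {\<omega> \<in> space M. X 0 \<omega> = - 1} \<and>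
     integrable M (\<lambda>\<omega>. real_of_int (X 0 \<omega>))"

end

(*
Fix n and look at the descendant tree t of the n-th ancestor of the root together with the position
a of the root in t. Let w(t) be the product of the probabilities \<pi>(k) over the numbers k of children
of the vertices of t. On the record side, the event that (t, a) occurs contains the event that the
increments on a window of length |t| are the numbers of children minus one, listed in depth-first
order (the Lukasiewicz path of t); this event has probability w(t). On the Galton-Watson side the
event has probability at least w(t) as well: the factor k of the size-biased law cancels against the
choice of the position of the spine among k siblings. By criticality, the sum of w(t) over all pairs
(t, a) with a of depth n is the mean size of generation n, which is 1. Since both families of events
are disjoint, they exhaust both probability spaces, so that (t, a), and with it the ball of radius n
around the root, has the same law on both sides. No separate recurrence argument is needed.
*)

theory Submission
  imports Defs
begin

section \<open>Finite plane trees\<close>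

text \<open>That the weights exhaust the mass 1 rests on almost sure extinction: generation sizes
  have mean 1 under the weights only if the weights of all finite plane trees sum to 1. The sum is
  at most 1 because on the Galton-Watson side distinct descendant trees of the root are disjoint
  events; it is not smaller because \<open>pmf p 0\<close> is positive, which reflects the positive
  probability of a step -1. Depth and radius agree for a reason: a walk from the root needs
  \<open>n\<close> steps to reach its \<open>n\<close>-th ancestor, so the ball of radius
  \<open>n\<close> cannot leave the descendant tree of that ancestor. Both graphs are treated
  through one notion, the embedding of a plane tree into a single-valued arc relation that raises an
  integer height. Height excludes cycles, so the graph determines the tree and the position of the
  root in it; this is what makes the events disjoint. The record map looks to the right, so a finite
  descendant tree fills the positions directly to the left of its top, with the last child nearest.
  This is why the depth-first order takes the last child first and the increments are read from
  right to left.\<close>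

datatype ptree = Node (subtrees: "ptree list")

instance ptree :: countable
  by countable_datatype

primrec subtree_at :: "ptree \<Rightarrow> nat list \<Rightarrow> ptree" where
  "subtree_at t [] = t"
| "subtree_at t (i # p) = subtree_at (subtrees t ! i) p"

primrec valid :: "ptree \<Rightarrow> nat list \<Rightarrow> bool" where
  "valid t [] \<longleftrightarrow> True"
| "valid t (i # p) \<longleftrightarrow> i < length (subtrees t) \<and> valid (subtrees t ! i) p"

abbreviation arity :: "ptree \<Rightarrow> nat list \<Rightarrow> nat" where
  "arity t p \<equiv> length (subtrees (subtree_at t p))"

lemma subtree_at_append: "subtree_at t (p @ q) = subtree_at (subtree_at t p) q"
  by (induction p arbitrary: t) auto

lemma valid_append: "valid t (p @ q) \<longleftrightarrow> valid t p \<and> valid (subtree_at t p) q"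
  by (induction p arbitrary: t) auto

lemma valid_snoc: "valid t (p @ [i]) \<longleftrightarrow> valid t p \<and> i < arity t p"
  by (simp add: valid_append)

lemma ptree_eqI: "(\<And>p. valid t p \<longleftrightarrow> valid t' p) \<Longrightarrow> t = t'"
proof (induction t arbitrary: t')
  case (Node ts)
  obtain ts' where t': "t' = Node ts'" by (cases t')
  have "i < length ts \<longleftrightarrow> i < length ts'" for i using Node.prems[of "[i]"] t' by simp
  then have len: "length ts = length ts'" by (metis linorder_neqE_nat less_irrefl)
  have "ts ! i = ts' ! i" if i: "i < length ts" for i
  proof (rule Node.IH)
    show "valid (ts ! i) p \<longleftrightarrow> valid (ts' ! i) p" for p
      using Node.prems[of "i # p"] i len t' by simp
  qed (use i in simp)
  then show ?case using len t' by (simp add: nth_equalityI)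
qed

section \<open>Embeddings of plane trees into parent graphs\<close>

text \<open>The children of \<open>f p\<close> are exactly the listed ones, at leaves too, so the
  image of \<open>f\<close> is the complete set of descendants of \<open>f []\<close>; what lies
  above \<open>f []\<close> is left open. The case \<open>i = j\<close> of the order condition keeps
  siblings distinct.\<close>

definition embeds :: "('v \<times> 'v) set \<Rightarrow> ('v \<times> 'v) set \<Rightarrow> (nat list \<Rightarrow> 'v) \<Rightarrow> ptree \<Rightarrow> bool" where
  "embeds E L f t \<longleftrightarrow> (\<forall>p. valid t p \<longrightarrow>
     {u. (u, f p) \<in> E} = (\<lambda>i. f (p @ [i])) ` {..<arity t p} \<and>
     (\<forall>i<arity t p. \<forall>j<arity t p. (f (p @ [i]), f (p @ [j])) \<in> L \<longleftrightarrow> i < j))"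

lemma embeds_children:
  "embeds E L f t \<Longrightarrow> valid t p \<Longrightarrow> {u. (u, f p) \<in> E} = (\<lambda>i. f (p @ [i])) ` {..<arity t p}"
  by (simp add: embeds_def)

lemma embeds_order:
  "embeds E L f t \<Longrightarrow> valid t p \<Longrightarrow> i < arity t p \<Longrightarrow> j < arity t p \<Longrightarrow>
    (f (p @ [i]), f (p @ [j])) \<in> L \<longleftrightarrow> i < j"
  by (simp add: embeds_def)

lemma embeds_arc:
  assumes "embeds E L f t" "valid t (p @ [i])"
  shows "(f (p @ [i]), f p) \<in> E"
proof -
  have "valid t p" "i < arity t p" using assms(2) by (simp_all add: valid_snoc)
  then have "f (p @ [i]) \<in> {u. (u, f p) \<in> E}"
    by (subst embeds_children[OF assms(1)]) auto
  then show ?thesis by simp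
qed

lemma ordered_enumeration_card:
  fixes g :: "nat \<Rightarrow> 'v"
  assumes "\<And>i j. i < n \<Longrightarrow> j < n \<Longrightarrow> (g i, g j) \<in> L \<longleftrightarrow> i < j"
  shows "inj_on g {..<n}"
    and "i < n \<Longrightarrow> card {u \<in> g ` {..<n}. (u, g i) \<in> L} = i"
proof -
  show inj: "inj_on g {..<n}"
  proof (rule linorder_inj_onI)
    fix i j assume "i < j" "i \<in> {..<n}" "j \<in> {..<n}"
    then show "g i \<noteq> g j" using assms[of i j] assms[of j j] by auto
  qed auto
  show "card {u \<in> g ` {..<n}. (u, g i) \<in> L} = i" if "i < n"
  proof -
    have "{u \<in> g ` {..<n}. (u, g i) \<in> L} = g ` {..<i}" using assms that by auto
    moreover have "inj_on g {..<i}" by (rule inj_on_subset[OF inj]) (use that in auto)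
    ultimately show ?thesis by (simp add: card_image)
  qed
qed

text \<open>The index of an element is the number of listed elements that precede it, and this
  depends only on the listed set.\<close>

lemma ordered_enumeration_unique:
  fixes g g' :: "nat \<Rightarrow> 'v"
  assumes g: "\<And>i j. i < n \<Longrightarrow> j < n \<Longrightarrow> (g i, g j) \<in> L \<longleftrightarrow> i < j"
    and g': "\<And>i j. i < n' \<Longrightarrow> j < n' \<Longrightarrow> (g' i, g' j) \<in> L \<longleftrightarrow> i < j"
    and eq: "g ` {..<n} = g' ` {..<n'}"
  shows "n = n'" and "i < n \<Longrightarrow> g i = g' i"
proof -
  have "inj_on g {..<n}" "inj_on g' {..<n'}" by (rule ordered_enumeration_card; fact)+
  then have "card (g ` {..<n}) = n" "card (g' ` {..<n'}) = n'" by (simp_all add: card_image)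
  then show "n = n'" using eq by simp
  show "g i = g' i" if "i < n"
  proof -
    have "g i \<in> g' ` {..<n'}" unfolding eq[symmetric] using that by simp
    then obtain j where j: "j < n'" "g i = g' j" by auto
    have "card {u \<in> g ` {..<n}. (u, g i) \<in> L} = i"
      by (rule ordered_enumeration_card(2)[OF _ that]) (fact g)
    moreover have "card {u \<in> g' ` {..<n'}. (u, g' j) \<in> L} = j"
      by (rule ordered_enumeration_card(2)[OF _ j(1)]) (fact g')
    ultimately have "i = j" using j eq by simp
    then show ?thesis using j by simp
  qed
qed

lemma embeds_determined:
  assumes "embeds E L f t" "embeds E L f' t'" "f [] = f' []" "valid t p"
  shows "valid t' p \<and> f p = f' p"
  using assms(4)
proof (induction p rule: rev_induct)
  case (snoc i p)
  then have p: "valid t p" "valid t' p" "f p = f' p" "i < arity t p" by (auto simp: valid_snoc)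
  have eq: "(\<lambda>i. f (p @ [i])) ` {..<arity t p} = (\<lambda>i. f' (p @ [i])) ` {..<arity t' p}"
    using embeds_children[OF assms(1) p(1)] embeds_children[OF assms(2) p(2)] p(3) by simp
  note * = ordered_enumeration_unique[OF embeds_order[OF assms(1) p(1)]
      embeds_order[OF assms(2) p(2)] eq]
  show ?case using * p by (auto simp: valid_snoc)
qed (use assms in simp)

lemma embeds_unique:
  assumes "embeds E L f t" "embeds E L f' t'" "f [] = f' []"
  shows "t = t'"
  using embeds_determined[OF assms] embeds_determined[OF assms(2,1) assms(3)[symmetric]]
  by (blast intro: ptree_eqI)

text \<open>Single-valuedness keeps the two climbs from the common vertex together, and equal depths
  let them arrive at the tops at the same time.\<close>

lemma embeds_root_eq:
  assumes sv: "single_valued E"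
    and "embeds E L f t" "embeds E L f' t'"
  shows "valid t a \<Longrightarrow> valid t' a' \<Longrightarrow> f a = f' a' \<Longrightarrow> length a = length a' \<Longrightarrow> f [] = f' []"
proof (induction a arbitrary: a' rule: rev_induct)
  case (snoc i a)
  then obtain b j where a': "a' = b @ [j]" by (cases a' rule: rev_cases) auto
  have "(f (a @ [i]), f a) \<in> E" "(f (a @ [i]), f' b) \<in> E"
    using embeds_arc[OF assms(2), of a i] embeds_arc[OF assms(3), of b j] snoc.prems a' by auto
  then have "f a = f' b" using sv by (simp add: single_valued_def)
  then show ?case using snoc a' by (auto simp: valid_snoc)
qed simp

lemma embeds_height:
  fixes h :: "'v \<Rightarrow> int"
  assumes "\<And>u v. (u, v) \<in> E \<Longrightarrow> h u < h v" "embeds E L f t"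
  shows "valid t p \<Longrightarrow> h (f p) + int (length p) \<le> h (f [])"
proof (induction p rule: rev_induct)
  case (snoc i p)
  have "h (f (p @ [i])) < h (f p)" using embeds_arc[OF assms(2) snoc.prems] by (rule assms(1))
  then show ?case using snoc by (simp add: valid_snoc)
qed simp

text \<open>A proper descendant has smaller height than \<open>f []\<close>, so it cannot be
  \<open>f []\<close> again. Elsewhere equal vertices have equal parents, and irreflexivity of the
  order on listed children separates siblings.\<close>

lemma embeds_inj:
  fixes h :: "'v \<Rightarrow> int"
  assumes sv: "single_valued E" and h: "\<And>u v. (u, v) \<in> E \<Longrightarrow> h u < h v"
    and f: "embeds E L f t"
  shows "valid t p \<Longrightarrow> valid t q \<Longrightarrow> f p = f q \<Longrightarrow> p = q"
proof (induction p arbitrary: q rule: rev_induct)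
  case Nil
  then show ?case using embeds_height[of E h, OF h f, of q] by auto
next
  case (snoc i p)
  show ?case
  proof (cases q rule: rev_cases)
    case Nil
    then show ?thesis using embeds_height[of E h, OF h f snoc.prems(1)] snoc.prems by auto
  next
    case q: (snoc p' j)
    have "(f q, f p) \<in> E" "(f q, f p') \<in> E"
      using embeds_arc[OF f, of p i] embeds_arc[OF f, of p' j] snoc.prems q by auto
    then have "f p = f p'" using sv by (simp add: single_valued_def)
    then have "p = p'" using snoc q by (simp add: valid_snoc)
    then have p: "valid t p" "i < arity t p" "j < arity t p" "f (p @ [i]) = f (p @ [j])"
      using snoc.prems q by (auto simp: valid_snoc)
    then have "i = j"
      using embeds_order[OF f p(1) p(2) p(3)] embeds_order[OF f p(1) p(2) p(2)]
        embeds_order[OF f p(1) p(3) p(2)] by auto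
    then show ?thesis using q \<open>p = p'\<close> by simp
  qed
qed

section \<open>Balls and local isomorphisms\<close>

lemma local_isomorphism_relpow:
  assumes root: "f (root_vertex K) = root_vertex G" "root_vertex K \<in> verts K"
    and K: "arcs K \<subseteq> verts K \<times> verts K"
    and arc: "\<And>u v. u \<in> verts K \<Longrightarrow> v \<in> verts K \<Longrightarrow> (u, v) \<in> arcs K \<longleftrightarrow> (f u, f v) \<in> arcs G"
    and loc: "\<And>k p u. k < r \<Longrightarrow> (root_vertex K, p) \<in> adj K ^^ k \<Longrightarrow> (f p, u) \<in> adj G \<Longrightarrow>
        u \<in> f ` verts K"
  shows "(root_vertex K, p) \<in> adj K ^^ k \<Longrightarrow> p \<in> verts K \<and> (root_vertex G, f p) \<in> adj G ^^ k"
    and "k \<le> r \<Longrightarrow> (root_vertex G, u) \<in> adj G ^^ k \<Longrightarrow>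
      \<exists>p\<in>verts K. u = f p \<and> (root_vertex K, p) \<in> adj K ^^ k"
proof -
  have adj: "(f u, f v) \<in> adj G \<longleftrightarrow> (u, v) \<in> adj K" if "u \<in> verts K" "v \<in> verts K" for u v
    using arc that by (auto simp: adj_def)
  show "p \<in> verts K \<and> (root_vertex G, f p) \<in> adj G ^^ k" if "(root_vertex K, p) \<in> adj K ^^ k"
    using that
  proof (induction k arbitrary: p)
    case (Suc k)
    then obtain q where q: "(root_vertex K, q) \<in> adj K ^^ k" "(q, p) \<in> adj K" by auto
    then have "q \<in> verts K" "p \<in> verts K" using K by (auto simp: adj_def)
    then show ?case using Suc.IH[OF q(1)] q(2) adj by auto
  qed (use root in auto)
  show "\<exists>p\<in>verts K. u = f p \<and> (root_vertex K, p) \<in> adj K ^^ k"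
    if "k \<le> r" "(root_vertex G, u) \<in> adj G ^^ k"
    using that
  proof (induction k arbitrary: u)
    case (Suc k)
    then obtain w where w: "(root_vertex G, w) \<in> adj G ^^ k" "(w, u) \<in> adj G" by auto
    then obtain p where p: "p \<in> verts K" "w = f p" "(root_vertex K, p) \<in> adj K ^^ k"
      using Suc by auto
    then obtain q where "q \<in> verts K" "u = f q" using loc[of k p u] w Suc.prems by auto
    then show ?case using p w adj by auto
  qed (use root in auto)
qed

text \<open>The map \<open>f\<close> may miss most of \<open>G\<close>: walks of length at most
  \<open>r\<close> lift step by step as long as the vertices reached in fewer than \<open>r\<close>
  steps have all their neighbours in the image. A vertex first reached at step \<open>r\<close> may
  have neighbours outside; the top of a finite descendant tree is such a vertex.\<close>

lemma local_isomorphism_ball: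
  assumes root: "f (root_vertex K) = root_vertex G" "root_vertex K \<in> verts K"
    and K: "arcs K \<subseteq> verts K \<times> verts K"
    and sub: "f ` verts K \<subseteq> verts G" and inj: "inj_on f (verts K)"
    and arc: "\<And>u v. u \<in> verts K \<Longrightarrow> v \<in> verts K \<Longrightarrow> (u, v) \<in> arcs K \<longleftrightarrow> (f u, f v) \<in> arcs G"
    and ord: "\<And>u v w. w \<in> verts K \<Longrightarrow> u \<in> verts K \<Longrightarrow> v \<in> verts K \<Longrightarrow> (u, w) \<in> arcs K \<Longrightarrow>
        (v, w) \<in> arcs K \<Longrightarrow> (u, v) \<in> sib_order K \<longleftrightarrow> (f u, f v) \<in> sib_order G"
    and loc: "\<And>k p u. k < r \<Longrightarrow> (root_vertex K, p) \<in> adj K ^^ k \<Longrightarrow> (f p, u) \<in> adj G \<Longrightarrow>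
        u \<in> f ` verts K"
  shows "isomorphic (root_ball r K) (root_ball r G)"
proof -
  have img: "f ` ball_verts r K = ball_verts r G"
  proof (intro equalityI subsetI)
    fix u assume "u \<in> f ` ball_verts r K"
    then obtain p k where p: "u = f p" "k \<le> r" "(root_vertex K, p) \<in> adj K ^^ k"
      by (auto simp: ball_verts_def)
    have "p \<in> verts K \<and> (root_vertex G, f p) \<in> adj G ^^ k"
      by (rule local_isomorphism_relpow(1)[of f, OF root K _ _ p(3)]) (erule (1) arc, erule (2) loc)
    then show "u \<in> ball_verts r G" using p sub by (auto simp: ball_verts_def)
  next
    fix u assume "u \<in> ball_verts r G"
    then obtain k where k: "k \<le> r" "(root_vertex G, u) \<in> adj G ^^ k"
      by (auto simp: ball_verts_def)
    have "\<exists>p\<in>verts K. u = f p \<and> (root_vertex K, p) \<in> adj K ^^ k"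
      by (rule local_isomorphism_relpow(2)[of f, OF root K _ _ k]) (erule (1) arc, erule (2) loc)
    then show "u \<in> f ` ball_verts r K" using k(1) by (auto simp: ball_verts_def)
  qed
  have bv: "ball_verts r K \<subseteq> verts K" by (auto simp: ball_verts_def)
  have "bij_betw f (ball_verts r K) (ball_verts r G)"
    using img inj bv by (auto simp: bij_betw_def intro: inj_on_subset)
  moreover have "f u \<in> ball_verts r G" if "u \<in> ball_verts r K" for u using img that by blast
  ultimately have "is_isomorphism f (root_ball r K) (root_ball r G)"
    using bv root arc ord unfolding is_isomorphism_def root_ball_def
    by (auto dest!: subsetD[OF bv])
  then show ?thesis by (auto simp: isomorphic_def)
qed

definition plane_tree_graph :: "ptree \<Rightarrow> nat list \<Rightarrow> nat list rooted_graph" where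
  "plane_tree_graph t a = \<lparr>verts = {p. valid t p}, arcs = {(p @ [i], p) | p i. valid t (p @ [i])},
     sib_order = {(p @ [i], p @ [j]) | p i j. i < j}, root_vertex = a\<rparr>"

lemma plane_tree_graph_relpow_length:
  "(a, p) \<in> adj (plane_tree_graph t a) ^^ k \<Longrightarrow> length a \<le> length p + k"
proof (induction k arbitrary: p)
  case (Suc k)
  then obtain q where "(a, q) \<in> adj (plane_tree_graph t a) ^^ k" "(q, p) \<in> adj (plane_tree_graph t a)"
    by auto
  then show ?case using Suc.IH[of q] by (auto simp: adj_def plane_tree_graph_def)
qed simp

text \<open>The only place where the component can leave the image of the tree is the parent of
  \<open>f []\<close>, and \<open>f []\<close> is at distance \<open>length a\<close> from the root.
  Hence the radius.\<close>

lemma ball_component_embedding: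
  fixes h :: "'v \<Rightarrow> int"
  assumes sv: "single_valued E" and h: "\<And>u v. (u, v) \<in> E \<Longrightarrow> h u < h v"
    and f: "embeds E L f t" and a: "valid t a" "f a = r"
  shows "isomorphic (root_ball (length a) (plane_tree_graph t a))
     (root_ball (length a) (component E L r))"
proof -
  let ?K = "plane_tree_graph t a" and ?G = "component E L r"
  define C where "C = {w. (r, w) \<in> (E \<union> E\<inverse>)\<^sup>*}"
  have G: "?G = \<lparr>verts = C, arcs = Restr E C, sib_order = L, root_vertex = r\<rparr>"
    by (simp add: C_def component_def Let_def)
  have step: "w \<in> C \<longleftrightarrow> v \<in> C" if "(v, w) \<in> E" for v w
    using that unfolding C_def mem_Collect_eq
    by (meson UnI1 UnI2 converseI rtrancl.rtrancl_into_rtrancl)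
  have toroot: "f p \<in> C \<longleftrightarrow> f [] \<in> C" if "valid t p" for p
    using that
  proof (induction p rule: rev_induct)
    case (snoc i p)
    then show ?case using step[OF embeds_arc[OF f, of p i]] by (simp add: valid_snoc)
  qed simp
  have "r \<in> C" by (simp add: C_def)
  then have fC: "f p \<in> C" if "valid t p" for p using toroot that a by metis
  have finj: "p = q" if "valid t p" "valid t q" "f p = f q" for p q
    using embeds_inj[of E h, OF sv h f] that by blast
  show ?thesis
  proof (rule local_isomorphism_ball[where f = f])
    show "f (root_vertex ?K) = root_vertex ?G" "root_vertex ?K \<in> verts ?K"
      using a by (simp_all add: plane_tree_graph_def G)
    show "arcs ?K \<subseteq> verts ?K \<times> verts ?K" by (auto simp: plane_tree_graph_def valid_snoc)
    show "f ` verts ?K \<subseteq> verts ?G" using fC by (auto simp: plane_tree_graph_def G)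
    show "inj_on f (verts ?K)" by (auto simp: plane_tree_graph_def inj_on_def dest: finj)
    show "(u, v) \<in> arcs ?K \<longleftrightarrow> (f u, f v) \<in> arcs ?G" if "u \<in> verts ?K" "v \<in> verts ?K" for u v
    proof
      assume "(u, v) \<in> arcs ?K"
      then show "(f u, f v) \<in> arcs ?G"
        using embeds_arc[OF f] fC by (auto simp: plane_tree_graph_def G valid_snoc)
    next
      assume uv: "(f u, f v) \<in> arcs ?G"
      have v: "valid t u" "valid t v" using that by (simp_all add: plane_tree_graph_def)
      have "f u \<in> {u. (u, f v) \<in> E}" using uv by (simp add: G)
      then obtain i where i: "i < arity t v" "f u = f (v @ [i])"
        unfolding embeds_children[OF f v(2)] by auto
      then have "u = v @ [i]" using v by (intro finj) (simp_all add: valid_snoc)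
      then show "(u, v) \<in> arcs ?K" using v i by (simp add: plane_tree_graph_def valid_snoc)
    qed
    show "(u, v) \<in> sib_order ?K \<longleftrightarrow> (f u, f v) \<in> sib_order ?G"
      if arcs: "(u, w) \<in> arcs ?K" "(v, w) \<in> arcs ?K" for u v w
    proof -
      obtain i j where ij: "u = w @ [i]" "v = w @ [j]" "valid t (w @ [i])" "valid t (w @ [j])"
        using arcs by (auto simp: plane_tree_graph_def)
      then show ?thesis using embeds_order[OF f, of w i j]
        by (simp add: plane_tree_graph_def G valid_snoc)
    qed
    fix k p u
    assume k: "k < length a" "(root_vertex ?K, p) \<in> adj ?K ^^ k" and u: "(f p, u) \<in> adj ?G"
    have "(a, p) \<in> adj ?K ^^ k" using k by (simp add: plane_tree_graph_def)
    \<comment> \<open>A step changes the depth by one, so fewer than \<open>length a\<close> steps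
      from \<open>a\<close> do not lead to the address \<open>[]\<close>; thus \<open>p\<close> has
      its parent inside the tree.\<close>
    then have len: "length p \<noteq> 0" using k(1) plane_tree_graph_relpow_length by fastforce
    have p: "valid t p"
    proof (cases k)
      case 0
      then show ?thesis using k a by (simp add: plane_tree_graph_def)
    next
      case (Suc m)
      then obtain q where "(q, p) \<in> adj ?K" using k by auto
      then show ?thesis by (auto simp: adj_def plane_tree_graph_def valid_snoc)
    qed
    obtain q i where q: "p = q @ [i]" using len by (cases p rule: rev_cases) auto
    consider "(f p, u) \<in> E" | "(u, f p) \<in> E" using u by (auto simp: adj_def G)
    then show "u \<in> f ` verts ?K"
    proof cases
      case 1
      then have "u = f q" using embeds_arc[OF f, of q i] p q sv by (auto simp: single_valued_def)
      then show ?thesis using p q by (auto simp: plane_tree_graph_def valid_snoc)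
    next
      case 2
      then have "u \<in> {u. (u, f p) \<in> E}" by simp
      then obtain j where "j < arity t p" "u = f (p @ [j])"
        unfolding embeds_children[OF f p] by auto
      then show ?thesis using p by (auto simp: plane_tree_graph_def valid_snoc)
    qed
  qed
qed

section \<open>The Borel sets of the local topology\<close>

lemma rooted_tree_cases:
  obtains G :: "nat rooted_graph" where "ordered_family_tree G" "T = iso_class G"
proof -
  obtain G where G: "same_tree G G" "T = abs_rooted_tree G"
    using Quotient_abs_rep[OF Quotient_rooted_tree] Quotient_rep_reflp[OF Quotient_rooted_tree]
    by metis
  then have ft: "ordered_family_tree G" by (simp add: same_tree_def)
  have "same_tree G (relabel to_nat G)"
    using ft isomorphic_relabel[of to_nat G]
    by (simp add: same_tree_def ordered_family_tree_relabel)
  then have "T = iso_class G"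
    unfolding G(2) iso_class_def by (rule Quotient_rel_abs[OF Quotient_rooted_tree])
  then show ?thesis using ft that by blast
qed

lemma root_ball_root:
  "ordered_family_tree G \<Longrightarrow> root_vertex (root_ball r G) \<in> verts (root_ball r G)"
  using family_tree_root[of G] by (auto simp: root_ball_def ball_verts_def intro!: exI[of _ 0])

lemma agree_upto_iso_class:
  fixes G :: "'v::countable rooted_graph" and H :: "'w::countable rooted_graph"
  assumes "ordered_family_tree G" "ordered_family_tree H"
  shows "agree_upto r (iso_class G) (iso_class H) \<longleftrightarrow>
    isomorphic (root_ball r G) (root_ball r H)"
proof -
  let ?G = "relabel to_nat G :: nat rooted_graph" and ?H = "relabel to_nat H :: nat rooted_graph"
  have ft: "ordered_family_tree ?G" "ordered_family_tree ?H"
    using assms by (auto intro: ordered_family_tree_relabel)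
  then have "same_tree ?G ?G" "same_tree ?H ?H" by (simp_all add: same_tree_def isomorphic_refl)
  then have "agree_upto r (iso_class G) (iso_class H) \<longleftrightarrow>
      isomorphic (root_ball r ?G) (root_ball r ?H)"
    unfolding iso_class_def by (rule agree_upto.abs_eq)
  moreover have "isomorphic (root_ball r G) (root_ball r ?G)"
    "isomorphic (root_ball r H) (root_ball r ?H)"
    using assms ft by (auto intro!: isomorphic_root_ball isomorphic_relabel)
  ultimately show ?thesis
    using assms ft by (meson isomorphic_sym isomorphic_trans root_ball_root)
qed

lemma root_ball_simps:
  "root_vertex (root_ball r G) = root_vertex G" "sib_order (root_ball r G) = sib_order G"
  "verts (root_ball r G) = ball_verts r G"
  "arcs (root_ball r G) = Restr (arcs G) (ball_verts r G)"
  by (simp_all add: root_ball_def)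

lemma ball_verts_step:
  assumes "ordered_family_tree G" "(root_vertex G, v) \<in> adj G ^^ k" "k < r" "(v, u) \<in> adj G"
  shows "u \<in> ball_verts r G"
proof -
  have "u \<in> verts G" using assms(4) family_tree_arcs[OF assms(1)] by (auto simp: adj_def)
  moreover have "(root_vertex G, u) \<in> adj G ^^ Suc k" using assms by auto
  ultimately show ?thesis using assms(3) unfolding ball_verts_def by (blast intro: Suc_leI)
qed

lemma root_ball_adj: "adj (root_ball r G) \<subseteq> adj G"
  by (auto simp: adj_def root_ball_simps)

text \<open>Vertices reached in fewer than \<open>r\<close> steps keep all their neighbours in
  \<open>root_ball r G\<close>. So this one graph is locally isomorphic to \<open>G\<close> by the
  identity and to \<open>H\<close> by the given isomorphism, and the balls of radius
  \<open>s\<close> are compared through it.\<close>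

lemma isomorphic_smaller_root_ball:
  assumes G: "ordered_family_tree G" and H: "ordered_family_tree H"
    and iso: "isomorphic (root_ball r G) (root_ball r H)" and s: "s \<le> r"
  shows "isomorphic (root_ball s G) (root_ball s H)"
proof -
  let ?K = "root_ball r G"
  have root: "root_vertex ?K \<in> verts ?K" using root_ball_root G by blast
  have sub: "arcs ?K \<subseteq> verts ?K \<times> verts ?K" by (auto simp: root_ball_simps)
  have "isomorphic (root_ball s ?K) (root_ball s G)"
  proof (rule local_isomorphism_ball[where f = id])
    fix k p u
    assume "k < s" "(root_vertex ?K, p) \<in> adj ?K ^^ k" "(id p, u) \<in> adj G"
    moreover have "adj ?K ^^ k \<subseteq> adj G ^^ k" by (induction k) (use root_ball_adj in force)+
    ultimately show "u \<in> id ` verts ?K"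
      using ball_verts_step[OF G, of p k r u] s
      by (auto simp: root_ball_simps)
  qed (use root sub in \<open>auto simp: root_ball_simps ball_verts_def\<close>)
  moreover obtain f where f: "is_isomorphism f ?K (root_ball r H)"
    using iso by (auto simp: isomorphic_def)
  have bij: "bij_betw f (ball_verts r G) (ball_verts r H)"
    and fr: "f (root_vertex G) = root_vertex H"
    using f by (simp_all add: is_isomorphism_def root_ball_simps)
  have fball: "f p \<in> ball_verts r H" if "p \<in> ball_verts r G" for p
    using bij that by (rule bij_betwE[rule_format])
  have arc: "(f u, f v) \<in> arcs H \<longleftrightarrow> (u, v) \<in> arcs ?K" if "u \<in> verts ?K" "v \<in> verts ?K" for u v
    using f that fball by (simp add: is_isomorphism_def root_ball_simps)
  have reach: "p \<in> verts ?K \<and> (root_vertex H, f p) \<in> adj H ^^ k"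
    if "(root_vertex G, p) \<in> adj ?K ^^ k" for p k
    using that
  proof (induction k arbitrary: p)
    case 0
    then show ?case using root fr by (simp add: root_ball_simps)
  next
    case (Suc k)
    then obtain q where q: "(root_vertex G, q) \<in> adj ?K ^^ k" "(q, p) \<in> adj ?K" by auto
    then have "q \<in> verts ?K" "p \<in> verts ?K" using sub by (auto simp: adj_def)
    then have "(f q, f p) \<in> adj H" using q(2) arc by (auto simp: adj_def)
    then show ?case using Suc.IH[OF q(1)] \<open>p \<in> verts ?K\<close> by auto
  qed
  have "isomorphic (root_ball s ?K) (root_ball s H)"
  proof (rule local_isomorphism_ball[where f = f])
    show "f (root_vertex ?K) = root_vertex H" using fr by (simp add: root_ball_simps)
    show "f ` verts ?K \<subseteq> verts H"
      using fball by (auto simp: root_ball_simps ball_verts_def)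
    show "inj_on f (verts ?K)" using bij by (simp add: bij_betw_def root_ball_simps)
    show "(u, v) \<in> arcs ?K \<longleftrightarrow> (f u, f v) \<in> arcs H" if "u \<in> verts ?K" "v \<in> verts ?K" for u v
      using arc that by simp
    show "(u, v) \<in> sib_order ?K \<longleftrightarrow> (f u, f v) \<in> sib_order H"
      if "w \<in> verts ?K" "u \<in> verts ?K" "v \<in> verts ?K" "(u, w) \<in> arcs ?K" "(v, w) \<in> arcs ?K" for u v w
      using f that unfolding is_isomorphism_def by (simp add: root_ball_simps)
    fix k p u
    assume k: "k < s" "(root_vertex ?K, p) \<in> adj ?K ^^ k" "(f p, u) \<in> adj H"
    then have "u \<in> ball_verts r H"
      using reach[of p k] s by (intro ball_verts_step[OF H, of "f p" k]) (auto simp: root_ball_simps)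
    then show "u \<in> f ` verts ?K" using bij by (simp add: bij_betw_def root_ball_simps)
  qed (use root sub in auto)
  moreover have "root_vertex (root_ball s ?K) \<in> verts (root_ball s ?K)"
    using root by (auto simp: root_ball_def ball_verts_def intro!: exI[of _ 0])
  ultimately show ?thesis by (meson isomorphic_sym isomorphic_trans)
qed

section \<open>Agreement up to a radius: equivalence relations that become finer as the radius
  grows\<close>

lemma agree_upto_refl: "agree_upto r T T"
proof -
  obtain G :: "nat rooted_graph" where "ordered_family_tree G" "T = iso_class G"
    by (rule rooted_tree_cases)
  then show ?thesis by (simp add: agree_upto_iso_class isomorphic_refl)
qed

lemma agree_upto_sym: "agree_upto r S T \<Longrightarrow> agree_upto r T S"
proof -
  obtain G H :: "nat rooted_graph" where "ordered_family_tree G" "S = iso_class G"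
    "ordered_family_tree H" "T = iso_class H"
    by (metis rooted_tree_cases)
  then show "agree_upto r S T \<Longrightarrow> agree_upto r T S"
    by (simp add: agree_upto_iso_class isomorphic_sym root_ball_root)
qed

lemma agree_upto_trans: "agree_upto r S T \<Longrightarrow> agree_upto r T U \<Longrightarrow> agree_upto r S U"
proof -
  obtain G H K :: "nat rooted_graph" where "ordered_family_tree G" "S = iso_class G"
    "ordered_family_tree H" "T = iso_class H" "ordered_family_tree K" "U = iso_class K"
    by (metis rooted_tree_cases)
  then show "agree_upto r S T \<Longrightarrow> agree_upto r T U \<Longrightarrow> agree_upto r S U"
    using isomorphic_trans by (auto simp: agree_upto_iso_class)
qed

lemma agree_upto_mono: "agree_upto r S T \<Longrightarrow> s \<le> r \<Longrightarrow> agree_upto s S T"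
proof -
  obtain G H :: "nat rooted_graph" where "ordered_family_tree G" "S = iso_class G"
    "ordered_family_tree H" "T = iso_class H"
    by (metis rooted_tree_cases)
  then show "agree_upto r S T \<Longrightarrow> s \<le> r \<Longrightarrow> agree_upto s S T"
    using isomorphic_smaller_root_ball by (simp add: agree_upto_iso_class)
qed

lemma agree_upto_0: "agree_upto 0 S T"
proof -
  obtain G H :: "nat rooted_graph" where GH: "ordered_family_tree G" "S = iso_class G"
    "ordered_family_tree H" "T = iso_class H"
    by (metis rooted_tree_cases)
  have ball: "ball_verts 0 K = {root_vertex K}" if "ordered_family_tree K" for K :: "nat rooted_graph"
    using family_tree_root[OF that] by (auto simp: ball_verts_def)
  have loop: "(v, v) \<notin> arcs K" if "ordered_family_tree K" for K :: "nat rooted_graph" and v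
    using that by (auto simp: ordered_family_tree_def directed_tree_def asym_on_def)
  have "is_isomorphism (\<lambda>_. root_vertex H) (root_ball 0 G) (root_ball 0 H)"
    unfolding is_isomorphism_def root_ball_simps ball[OF GH(1)] ball[OF GH(3)]
    using loop[OF GH(1)] loop[OF GH(3)] by (auto simp: bij_betw_def)
  then show ?thesis using GH by (auto simp: agree_upto_iso_class isomorphic_def)
qed

section \<open>A countable generator of the Borel sets\<close>

lemma finite_ball_verts:
  assumes "ordered_family_tree G"
  shows "finite (ball_verts r G)"
proof -
  have nb: "finite {u. (v, u) \<in> adj G}" for v
  proof -
    have sv: "single_valued (arcs G)" using assms by (simp add: ordered_family_tree_def)
    have "finite {u. (v, u) \<in> arcs G}"
    proof (cases "{u. (v, u) \<in> arcs G} = {}")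
      case False
      then obtain w where "(v, w) \<in> arcs G" by auto
      then have "{u. (v, u) \<in> arcs G} \<subseteq> {w}" using sv by (auto simp: single_valued_def)
      then show ?thesis by (rule finite_subset) simp
    qed simp
    moreover have "finite {u. (u, v) \<in> arcs G}"
    proof (cases "v \<in> verts G")
      case True
      then show ?thesis using assms by (auto simp: ordered_family_tree_def children_def)
    next
      case False
      then have "{u. (u, v) \<in> arcs G} = {}" using family_tree_arcs[OF assms] by blast
      then show ?thesis by simp
    qed
    moreover have "{u. (v, u) \<in> adj G} = {u. (v, u) \<in> arcs G} \<union> {u. (u, v) \<in> arcs G}"
      by (auto simp: adj_def)
    ultimately show ?thesis by simp
  qed
  have fin: "finite {u. (root_vertex G, u) \<in> adj G ^^ k}" for k
  proof (induction k)
    case (Suc k)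
    have "{u. (root_vertex G, u) \<in> adj G ^^ Suc k} =
        (\<Union>v\<in>{v. (root_vertex G, v) \<in> adj G ^^ k}. {u. (v, u) \<in> adj G})" by auto
    then show ?case using Suc nb by simp
  qed simp
  have "ball_verts r G \<subseteq> (\<Union>k\<in>{..r}. {u. (root_vertex G, u) \<in> adj G ^^ k})"
    by (auto simp: ball_verts_def)
  then show ?thesis using fin by (auto intro: finite_subset)
qed

definition agree_sets :: "rooted_tree set set" where
  "agree_sets = {Collect (agree_upto r T) | r T. True}"

text \<open>A ball has finitely many vertices, so each set is coded by a radius and a finite graph
  on natural numbers. The sibling order is cut down to the ball because the relation itself may be
  infinite; pairs outside the ball do not affect isomorphisms.\<close>

lemma countable_agree_sets: "countable agree_sets"
proof -
  define fg where "fg = (\<lambda>(V, A, B, x). \<lparr>verts = V, arcs = A, sib_order = B, root_vertex = x\<rparr>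
    :: nat rooted_graph)"
  define S where "S = (\<lambda>(r, F). {T. \<exists>H :: nat rooted_graph. ordered_family_tree H \<and>
    T = iso_class H \<and> isomorphic (fg F) (root_ball r H)})"
  let ?I = "(UNIV :: nat set) \<times> {V :: nat set. finite V} \<times> {A :: (nat \<times> nat) set. finite A} \<times>
    {B :: (nat \<times> nat) set. finite B} \<times> (UNIV :: nat set)"
  have "agree_sets \<subseteq> S ` ?I"
  proof
    fix A assume "A \<in> agree_sets"
    then obtain r T where A: "A = Collect (agree_upto r T)" by (auto simp: agree_sets_def)
    obtain G :: "nat rooted_graph" where G: "ordered_family_tree G" "T = iso_class G"
      by (rule rooted_tree_cases)
    define V where "V = ball_verts r G"
    define F where "F = (V, Restr (arcs G) V, Restr (sib_order G) V, root_vertex G)"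
    have V: "finite V" unfolding V_def by (rule finite_ball_verts[OF G(1)])
    then have "finite (V \<times> V)" by simp
    then have F: "(r, F) \<in> ?I" using V by (auto simp: F_def intro: finite_subset[where B = "V \<times> V"])
    have id: "is_isomorphism id (fg F) (root_ball r G)" "is_isomorphism id (root_ball r G) (fg F)"
      by (auto simp: is_isomorphism_def fg_def F_def root_ball_simps V_def)
    then have iso: "isomorphic (fg F) K \<longleftrightarrow> isomorphic (root_ball r G) K" for K :: "nat rooted_graph"
      by (meson isomorphic_def isomorphic_trans)
    have "A = S (r, F)"
    proof (intro equalityI subsetI)
      fix U assume "U \<in> A"
      moreover obtain H :: "nat rooted_graph" where "ordered_family_tree H" "U = iso_class H"
        by (rule rooted_tree_cases)
      ultimately show "U \<in> S (r, F)" using G by (auto simp: A S_def iso agree_upto_iso_class)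
    next
      fix U assume "U \<in> S (r, F)"
      then show "U \<in> A" using G by (auto simp: A S_def iso agree_upto_iso_class)
    qed
    then show "A \<in> S ` ?I" using F by blast
  qed
  moreover have "countable ?I" 
    by (intro countable_SIGMA countable_Collect_finite countableI_type)
  ultimately show ?thesis by (meson countable_image countable_subset)
qed

text \<open>By transitivity every point of a basic set is a centre of it, as in an ultrametric
  space, and for an intersection the larger radius serves.\<close>

lemma open_rooted_tree_neighbourhood:
  assumes "open U" "T \<in> U"
  shows "\<exists>r. Collect (agree_upto r T) \<subseteq> U"
proof -
  have "generate_topology (range (\<lambda>(r, T). {T'. agree_upto r T T'})) U"
    using assms(1) by (simp add: open_rooted_tree_def)
  then show ?thesis using assms(2)
  proof (induction arbitrary: T)
    case (Int A B)
    then obtain r s where "Collect (agree_upto r T) \<subseteq> A" "Collect (agree_upto s T) \<subseteq> B"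
      by (metis IntE)
    then have "Collect (agree_upto (max r s) T) \<subseteq> A \<inter> B"
      using agree_upto_mono[of "max r s" T _ r] agree_upto_mono[of "max r s" T _ s] by auto
    then show ?case by blast
  next
    case (Basis A)
    then show ?case using agree_upto_trans by blast
  qed blast+
qed

lemma open_agree_set: "open (Collect (agree_upto r T))"
  unfolding open_rooted_tree_def by (rule generate_topology.Basis) auto

lemma open_rooted_tree_eq_Union:
  assumes "open U"
  shows "U = \<Union>{A \<in> agree_sets. A \<subseteq> U}"
proof (intro equalityI subsetI)
  fix T assume "T \<in> U"
  then obtain r where "Collect (agree_upto r T) \<subseteq> U"
    using open_rooted_tree_neighbourhood[OF assms] by blast
  moreover have "T \<in> Collect (agree_upto r T)" by (simp add: agree_upto_refl)
  moreover have "Collect (agree_upto r T) \<in> agree_sets" by (auto simp: agree_sets_def)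
  ultimately show "T \<in> \<Union>{A \<in> agree_sets. A \<subseteq> U}" by blast
qed auto

lemma sets_borel_rooted_tree: "sets (borel :: rooted_tree measure) = sigma_sets UNIV agree_sets"
proof -
  have "sets (borel :: rooted_tree measure) = sigma_sets UNIV {U. open U}"
    by (simp add: borel_def)
  also have "\<dots> = sigma_sets UNIV agree_sets"
  proof (rule sigma_sets_eqI)
    fix U :: "rooted_tree set" assume "U \<in> {U. open U}"
    then have "U = \<Union>{A \<in> agree_sets. A \<subseteq> U}" using open_rooted_tree_eq_Union by simp
    moreover have "\<Union>{A \<in> agree_sets. A \<subseteq> U} \<in> sigma_sets UNIV agree_sets"
      by (rule sigma_sets_UNION)
        (auto intro: countable_subset[OF _ countable_agree_sets])
    ultimately show "U \<in> sigma_sets UNIV agree_sets" by simp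
  next
    fix U assume "U \<in> agree_sets"
    then show "U \<in> sigma_sets UNIV {U. open U}"
      using open_agree_set by (auto simp: agree_sets_def)
  qed
  finally show ?thesis .
qed

lemma measurable_rooted_treeI:
  assumes "\<And>r T. {\<omega> \<in> space M. agree_upto r T (f \<omega>)} \<in> sets M"
  shows "f \<in> M \<rightarrow>\<^sub>M (borel :: rooted_tree measure)"
proof (rule measurable_sigma_sets[where \<Omega> = UNIV and A = agree_sets])
  fix A assume "A \<in> agree_sets"
  then obtain r T where "A = Collect (agree_upto r T)" by (auto simp: agree_sets_def)
  then have "f -` A \<inter> space M = {\<omega> \<in> space M. agree_upto r T (f \<omega>)}" by auto
  then show "f -` A \<inter> space M \<in> sets M" using assms by simp
qed (auto simp: sets_borel_rooted_tree)

text \<open>Two agreement sets are either disjoint or nested, so together with \<open>{}\<close>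
  they are stable under intersection. Radius 0 supplies the whole space.\<close>

lemma measure_eqI_rooted_tree:
  fixes P Q :: "rooted_tree measure"
  assumes sets: "sets P = sets borel" "sets Q = sets borel"
    and P: "prob_space P" and Q: "prob_space Q"
    and eq: "\<And>r T. emeasure P (Collect (agree_upto r T)) = emeasure Q (Collect (agree_upto r T))"
  shows "P = Q"
proof (rule measure_eqI_generator_eq[where \<Omega> = UNIV and E = "insert {} agree_sets"
      and A = "\<lambda>_. UNIV"])
  show "Int_stable (insert {} agree_sets)"
  proof (rule Int_stableI)
    have nested: "Collect (agree_upto r S) \<inter> Collect (agree_upto s T) \<in> insert {} agree_sets"
      if "r \<le> s" for r s S T
    proof (cases "Collect (agree_upto r S) \<inter> Collect (agree_upto s T) = {}")
      case False
      then obtain U where U: "agree_upto r S U" "agree_upto s T U" by blast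
      have "agree_upto r S V" if V: "agree_upto s T V" for V
        using agree_upto_mono[OF agree_upto_trans[OF agree_upto_sym[OF U(2)] V] \<open>r \<le> s\<close>] U(1)
        by (blast intro: agree_upto_trans)
      then have "Collect (agree_upto r S) \<inter> Collect (agree_upto s T) = Collect (agree_upto s T)"
        by blast
      then show ?thesis by (auto simp: agree_sets_def)
    qed simp
    fix A B assume "A \<in> insert {} agree_sets" "B \<in> insert {} agree_sets"
    then consider "A \<inter> B = {}" | r S s T where "A = Collect (agree_upto r S)"
      "B = Collect (agree_upto s T)" by (auto simp: agree_sets_def)
    then show "A \<inter> B \<in> insert {} agree_sets"
    proof cases
      case 2
      then show ?thesis using nested[of r s S T] nested[of s r T S]
        by (cases "r \<le> s") (simp_all add: Int_commute)
    qed simp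
  qed
  show "emeasure P X = emeasure Q X" if "X \<in> insert {} agree_sets" for X
    using that eq by (auto simp: agree_sets_def)
  have "sigma_sets UNIV (insert {} agree_sets) = sigma_sets UNIV agree_sets"
    by (intro sigma_sets_eqI) (auto intro: sigma_sets.Empty)
  then show "sets P = sigma_sets UNIV (insert {} agree_sets)"
    "sets Q = sigma_sets UNIV (insert {} agree_sets)"
    by (simp_all add: sets sets_borel_rooted_tree)
  have "Collect (agree_upto 0 T) = UNIV" for T by (auto simp: agree_upto_0)
  then show "range (\<lambda>_::nat. UNIV) \<subseteq> insert {} agree_sets" by (auto simp: agree_sets_def)
  show "emeasure P UNIV \<noteq> \<infinity>" using P prob_space.emeasure_le_1[OF P, of UNIV]
    by (auto simp: top_unique)
qed auto

section \<open>Measurability of a random rooted tree\<close>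

lemma measurable_iso_class:
  fixes G :: "'a \<Rightarrow> 'v::countable rooted_graph"
  assumes ft: "\<And>\<omega>. ordered_family_tree (G \<omega>)"
    and verts [measurable]: "\<And>v. Measurable.pred M (\<lambda>\<omega>. v \<in> verts (G \<omega>))"
    and arcs [measurable]: "\<And>u v. Measurable.pred M (\<lambda>\<omega>. (u, v) \<in> arcs (G \<omega>))"
    and order [measurable]: "\<And>u v. Measurable.pred M (\<lambda>\<omega>. (u, v) \<in> sib_order (G \<omega>))"
    and root: "\<And>\<omega>. root_vertex (G \<omega>) = r"
  shows "(\<lambda>\<omega>. iso_class (G \<omega>)) \<in> M \<rightarrow>\<^sub>M borel"
proof (rule measurable_rooted_treeI)
  fix n T
  obtain F :: "nat rooted_graph" where F: "ordered_family_tree F" "T = iso_class F"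
    by (rule rooted_tree_cases)
  let ?K = "root_ball n F"
  have fin: "finite (verts ?K)" by (simp add: root_ball_simps finite_ball_verts[OF F(1)])
  then obtain N where N: "verts ?K \<subseteq> {..<N}" by (meson finite_nat_iff_bounded)
  have rootK: "root_vertex ?K \<in> verts ?K" by (rule root_ball_root[OF F(1)])
  \<comment> \<open>Only the values of an isomorphism on the finite ball matter, so countably many maps suffice.\<close>
  have iso: "isomorphic ?K H \<longleftrightarrow> (\<exists>vs :: 'v list. is_isomorphism ((!) vs) ?K H)"
    for H :: "'v rooted_graph"
  proof
    assume "isomorphic ?K H"
    then obtain f where f: "is_isomorphism f ?K H" by (auto simp: isomorphic_def)
    let ?vs = "map f [0..<N]"
    have eq: "?vs ! i = f i" if "i \<in> verts ?K" for i using N that by auto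
    then have "bij_betw ((!) ?vs) (verts ?K) (verts H) = bij_betw f (verts ?K) (verts H)"
      by (rule bij_betw_cong)
    then have "is_isomorphism ((!) ?vs) ?K H"
      using f rootK unfolding is_isomorphism_def by (simp add: eq del: map_upt_Suc)
    then show "\<exists>vs :: 'v list. is_isomorphism ((!) vs) ?K H" by blast
  qed (auto simp: isomorphic_def)
  have adj [measurable]: "Measurable.pred M (\<lambda>\<omega>. (u, v) \<in> adj (G \<omega>))" for u v
    unfolding adj_def by simp
  have reach [measurable]: "Measurable.pred M (\<lambda>\<omega>. (r, v) \<in> adj (G \<omega>) ^^ k)" for v k
  proof (induction k arbitrary: v)
    case (Suc k)
    have [measurable]: "Measurable.pred M (\<lambda>\<omega>. (r, v) \<in> adj (G \<omega>) ^^ k)" for v by (rule Suc)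
    have "(\<lambda>\<omega>. (r, v) \<in> adj (G \<omega>) ^^ Suc k) =
        (\<lambda>\<omega>. \<exists>u. (r, u) \<in> adj (G \<omega>) ^^ k \<and> (u, v) \<in> adj (G \<omega>))"
      by (auto simp: fun_eq_iff)
    then show ?case by simp
  qed simp
  have ball [measurable]: "Measurable.pred M (\<lambda>\<omega>. v \<in> ball_verts n (G \<omega>))" for v
    unfolding ball_verts_def mem_Collect_eq root by simp
  have "Measurable.pred M (\<lambda>\<omega>. is_isomorphism ((!) vs) ?K (root_ball n (G \<omega>)))" for vs
  proof -
    \<comment> \<open>With \<open>?K\<close> and \<open>vs\<close> fixed, everything random is
      membership of single vertices or pairs. Surjectivity onto the random ball is written as a
      quantifier over the countable vertex type.\<close>
    have "(\<lambda>\<omega>. is_isomorphism ((!) vs) ?K (root_ball n (G \<omega>))) = (\<lambda>\<omega>.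
      (inj_on ((!) vs) (verts ?K) \<and> (\<forall>i\<in>verts ?K. vs ! i \<in> ball_verts n (G \<omega>)) \<and>
        (\<forall>v. v \<in> ball_verts n (G \<omega>) \<longrightarrow> v \<in> (!) vs ` verts ?K)) \<and>
      vs ! root_vertex ?K = r \<and>
      (\<forall>u\<in>verts ?K. \<forall>v\<in>verts ?K. (u, v) \<in> arcs ?K \<longleftrightarrow> (vs ! u, vs ! v) \<in> arcs (G \<omega>) \<and>
         vs ! u \<in> ball_verts n (G \<omega>) \<and> vs ! v \<in> ball_verts n (G \<omega>)) \<and>
      (\<forall>w\<in>verts ?K. \<forall>u\<in>verts ?K. \<forall>v\<in>verts ?K. (u, w) \<in> arcs ?K \<and> (v, w) \<in> arcs ?K \<longrightarrow>
        ((u, v) \<in> sib_order ?K \<longleftrightarrow> (vs ! u, vs ! v) \<in> sib_order (G \<omega>))))"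
      unfolding is_isomorphism_def bij_betw_def root_ball_simps(1,2)[of n "G _"] root
        root_ball_simps(3,4)[of n "G _"]
      by (intro ext arg_cong2[where f = "(\<and>)"] refl) (auto simp: image_subset_iff)
    also have "Measurable.pred M \<dots>" by measurable
    finally show ?thesis .
  qed
  then have "Measurable.pred M (\<lambda>\<omega>. \<exists>vs. is_isomorphism ((!) vs) ?K (root_ball n (G \<omega>)))"
    by measurable
  then show "{\<omega> \<in> space M. agree_upto n T (iso_class (G \<omega>))} \<in> sets M"
    unfolding F(2) agree_upto_iso_class[OF F(1) ft] iso by (simp add: pred_def)
qed

section \<open>Weights of plane trees\<close>

fun weight :: "nat pmf \<Rightarrow> ptree \<Rightarrow> ennreal" where
  "weight p (Node ts) = ennreal (pmf p (length ts)) * (\<Prod>t\<leftarrow>ts. weight p t)"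

lemma weight_Node: "weight p (Node ts) = ennreal (pmf p (length ts)) * (\<Prod>i<length ts. weight p (ts ! i))"
  by (simp add: prod.list_conv_set_nth lessThan_atLeast0)

definition marked_trees :: "nat \<Rightarrow> (ptree \<times> nat list) set" where
  "marked_trees n = {(t, a). valid t a \<and> length a = n}"

section \<open>Sums over lists of subtrees with values in \<open>ennreal\<close>\<close>

lemma nn_integral_count_space_list:
  fixes f :: "'b list \<Rightarrow> ennreal"
  shows "(\<integral>\<^sup>+xs. f xs \<partial>count_space UNIV) =
    f [] + (\<integral>\<^sup>+x. \<integral>\<^sup>+xs. f (x # xs) \<partial>count_space UNIV \<partial>count_space UNIV)"
proof -
  have "bij_betw (\<lambda>(x, xs). x # xs) UNIV (UNIV - {[] :: 'b list})"
    by (rule bij_betw_byWitness[where f' = "\<lambda>xs. (hd xs, tl xs)"]) auto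
  then have "(\<integral>\<^sup>+xs. f xs \<partial>count_space (UNIV - {[]})) =
      (\<integral>\<^sup>+y. f (case y of (x, xs) \<Rightarrow> x # xs) \<partial>count_space UNIV)"
    by (rule nn_integral_bij_count_space[symmetric])
  also have "\<dots> = (\<integral>\<^sup>+x. \<integral>\<^sup>+xs. f (x # xs) \<partial>count_space UNIV \<partial>count_space UNIV)"
    by (subst nn_integral_fst_count_space[symmetric]) simp
  finally have *: "(\<integral>\<^sup>+xs. f xs \<partial>count_space (UNIV - {[]})) = \<dots>" .
  have "(\<integral>\<^sup>+xs. f xs \<partial>count_space UNIV) =
      (\<integral>\<^sup>+xs. f xs * indicator {[]} xs + f xs * indicator (UNIV - {[]}) xs \<partial>count_space UNIV)"
    by (intro nn_integral_cong) (auto split: split_indicator)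
  also have "\<dots> = (\<integral>\<^sup>+xs. f xs * indicator {[]} xs \<partial>count_space UNIV) +
      (\<integral>\<^sup>+xs. f xs * indicator (UNIV - {[]}) xs \<partial>count_space UNIV)"
    by (rule nn_integral_add) auto
  also have "(\<integral>\<^sup>+xs. f xs * indicator {[]} xs \<partial>count_space UNIV) = f []"
    by (subst nn_integral_count_space_indicator[symmetric]) (auto simp: nn_integral_count_space_finite)
  also have "(\<integral>\<^sup>+xs. f xs * indicator (UNIV - {[]}) xs \<partial>count_space UNIV) =
      (\<integral>\<^sup>+xs. f xs \<partial>count_space (UNIV - {[]}))"
    by (rule nn_integral_count_space_indicator[symmetric]) simp
  finally show ?thesis by (simp add: *)
qed

lemma nn_integral_lists_prod:
  "(\<integral>\<^sup>+xs. (if length xs = k then \<Prod>x\<leftarrow>xs. g x else 0) \<partial>count_space UNIV) =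
    (\<integral>\<^sup>+x. g x \<partial>count_space UNIV) ^ k"
proof (induction k)
  case 0
  then show ?case by (subst nn_integral_count_space_list) simp
next
  case (Suc k)
  have "(\<integral>\<^sup>+xs. (if length xs = Suc k then \<Prod>x\<leftarrow>xs. g x else 0) \<partial>count_space UNIV) =
      (\<integral>\<^sup>+x. \<integral>\<^sup>+xs. g x * (if length xs = k then \<Prod>x\<leftarrow>xs. g x else 0) \<partial>count_space UNIV \<partial>count_space UNIV)"
    by (subst nn_integral_count_space_list) (auto intro!: nn_integral_cong)
  also have "\<dots> = (\<integral>\<^sup>+x. g x \<partial>count_space UNIV) ^ Suc k"
    by (simp add: nn_integral_cmult nn_integral_multc Suc)
  finally show ?case .
qed

text \<open>This is linearity of expectation for \<open>k\<close> independent entries of law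
  \<open>g\<close>: each entry contributes the weighted sum of \<open>z\<close>, while the other
  entries sum to 1.\<close>

lemma nn_integral_lists_prod_sum:
  assumes "(\<integral>\<^sup>+x. g x \<partial>count_space UNIV) = 1"
  shows "(\<integral>\<^sup>+xs. (if length xs = k then (\<Prod>x\<leftarrow>xs. g x) * (\<Sum>x\<leftarrow>xs. z x) else 0) \<partial>count_space UNIV) =
    of_nat k * (\<integral>\<^sup>+x. g x * z x \<partial>count_space UNIV)"
proof (induction k)
  case 0
  then show ?case by (subst nn_integral_count_space_list) simp
next
  case (Suc k)
  let ?Z = "\<integral>\<^sup>+x. g x * z x \<partial>count_space UNIV"
  have "(\<integral>\<^sup>+xs. (if length xs = Suc k then (\<Prod>x\<leftarrow>xs. g x) * (\<Sum>x\<leftarrow>xs. z x) else 0) \<partial>count_space UNIV) =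
      (\<integral>\<^sup>+x. \<integral>\<^sup>+xs. (g x * z x) * (if length xs = k then \<Prod>x\<leftarrow>xs. g x else 0) +
        g x * (if length xs = k then (\<Prod>x\<leftarrow>xs. g x) * (\<Sum>x\<leftarrow>xs. z x) else 0)
        \<partial>count_space UNIV \<partial>count_space UNIV)"
    by (subst nn_integral_count_space_list) (auto intro!: nn_integral_cong simp: algebra_simps)
  also have "\<dots> = ?Z + of_nat k * ?Z"
    by (simp add: nn_integral_add nn_integral_cmult nn_integral_multc Suc nn_integral_lists_prod assms)
  finally show ?case by (simp add: algebra_simps)
qed

text \<open>Grouping by length separates the offspring probability \<open>h\<close> of a vertex from
  the sum over its subtrees.\<close>

lemma nn_integral_by_length:
  fixes G :: "'b list \<Rightarrow> ennreal"
  shows "(\<integral>\<^sup>+xs. h (length xs) * G xs \<partial>count_space UNIV) =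
    (\<integral>\<^sup>+k. h k * (\<integral>\<^sup>+xs. (if length xs = k then G xs else 0) \<partial>count_space UNIV) \<partial>count_space UNIV)"
proof -
  have "(\<integral>\<^sup>+xs. h (length xs) * G xs \<partial>count_space UNIV) =
      (\<integral>\<^sup>+xs. \<integral>\<^sup>+k. h k * (if length xs = k then G xs else 0) \<partial>count_space UNIV \<partial>count_space UNIV)"
  proof (rule nn_integral_cong)
    fix xs :: "'b list"
    have "(\<integral>\<^sup>+k. h k * (if length xs = k then G xs else 0) \<partial>count_space UNIV) =
        (\<integral>\<^sup>+k. h (length xs) * G xs * indicator {length xs} k \<partial>count_space UNIV)"
      by (intro nn_integral_cong) (auto split: split_indicator)
    then show "h (length xs) * G xs = (\<integral>\<^sup>+k. h k * (if length xs = k then G xs else 0) \<partial>count_space UNIV)"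
      by (simp add: nn_integral_cmult_indicator)
  qed
  also have "\<dots> = (\<integral>\<^sup>+k. \<integral>\<^sup>+xs. h k * (if length xs = k then G xs else 0) \<partial>count_space UNIV \<partial>count_space UNIV)"
    using nn_integral_fst_count_space[of "\<lambda>(xs, k). h k * (if length xs = k then G xs else 0)"]
      nn_integral_snd_count_space[of "\<lambda>(xs, k). h k * (if length xs = k then G xs else 0)"]
    by simp
  finally show ?thesis by (simp add: nn_integral_cmult)
qed

lemma nn_integral_ptree:
  "(\<integral>\<^sup>+t. f t \<partial>count_space UNIV) = (\<integral>\<^sup>+ts. f (Node ts) \<partial>count_space UNIV)"
  by (rule nn_integral_bij_count_space[symmetric])
    (auto simp: bij_betw_def inj_on_def image_iff intro: ptree.exhaust_sel)

section \<open>Critical offspring: extinction and mean generation size\<close>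

locale critical_offspring =
  fixes p :: "nat pmf"
  assumes integrable_real: "integrable p real"
    and mean_one: "measure_pmf.expectation p real = 1"
    and pmf_0_pos: "0 < pmf p 0"
begin

lemma nn_mean_one: "(\<integral>\<^sup>+k. ennreal (pmf p k) * of_nat k \<partial>count_space UNIV) = 1"
proof -
  have "(\<integral>\<^sup>+k. ennreal (pmf p k) * of_nat k \<partial>count_space UNIV) = (\<integral>\<^sup>+k. ennreal (real k) \<partial>p)"
    by (simp add: nn_integral_measure_pmf ennreal_of_nat_eq_real_of_nat)
  also have "\<dots> = 1"
    by (subst nn_integral_eq_integral) (auto simp: integrable_real mean_one)
  finally show ?thesis .
qed

abbreviation total_weight :: ennreal where
  "total_weight \<equiv> \<integral>\<^sup>+t. weight p t \<partial>count_space UNIV"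

text \<open>The total weight is the probability that a Galton-Watson tree is finite; conditioning on
  the number of children of its root gives the classical equation with the generating function of
  \<open>p\<close>.\<close>

lemma total_weight_fixpoint: "total_weight = (\<integral>\<^sup>+k. total_weight ^ k \<partial>p)"
proof -
  have "total_weight = (\<integral>\<^sup>+ts. ennreal (pmf p (length ts)) * (\<Prod>t\<leftarrow>ts. weight p t) \<partial>count_space UNIV)"
    by (subst nn_integral_ptree) simp
  then show ?thesis
    by (simp add: nn_integral_by_length[where h = "\<lambda>k. ennreal (pmf p k)"] nn_integral_lists_prod
        nn_integral_measure_pmf)
qed

\<comment> \<open>A fixed point \<open>q < 1\<close> would make Bernoulli's inequality \<open>q ^ k \<ge> 1 + k * (q - 1)\<close> an equality
  on the support of \<open>p\<close>, so that no vertex has more than one child.\<close>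
lemma total_weight_eq_1:
  assumes le: "total_weight \<le> 1"
  shows "total_weight = 1"
proof (rule ccontr)
  assume ne: "total_weight \<noteq> 1"
  define q where "q = enn2real total_weight"
  have fin: "total_weight < top" using le by (rule le_less_trans) simp
  have W: "total_weight = ennreal q" using fin by (simp add: q_def)
  have q: "0 \<le> q" "q < 1"
  proof -
    show "0 \<le> q" by (simp add: q_def)
    have "q \<le> 1" using le W by (simp add: ennreal_le_1)
    moreover have "q \<noteq> 1" using ne W by auto
    ultimately show "q < 1" by simp
  qed
  have int: "integrable p (\<lambda>k. q ^ k)"
    by (rule measure_pmf.integrable_const_bound[where B = 1]) (use q in \<open>auto simp: power_le_one\<close>)
  have "ennreal (\<integral>k. q ^ k \<partial>p) = (\<integral>\<^sup>+k. ennreal (q ^ k) \<partial>p)"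
    using int q by (intro nn_integral_eq_integral[symmetric]) auto
  also have "\<dots> = ennreal q" using total_weight_fixpoint q by (simp add: W ennreal_power)
  finally have fix_q: "(\<integral>k. q ^ k \<partial>p) = q"
    using q by (subst (asm) ennreal_inj) (auto intro: integral_nonneg_AE)
  let ?f = "\<lambda>k. q ^ k - 1 - real k * (q - 1)"
  have "(\<integral>k. ?f k \<partial>p) = 0" using int integrable_real fix_q mean_one by simp
  moreover have nonneg: "0 \<le> ?f k" for k
    using Bernoulli_inequality[of "q - 1" k] q by (simp add: algebra_simps)
  moreover have "integrable p ?f" using int integrable_real by simp
  ultimately have zero: "?f k = 0" if "k \<in> set_pmf p" for k
    using integral_nonneg_eq_0_iff_AE[of p ?f] that by (auto simp: AE_measure_pmf_iff)
  have le1: "k \<le> 1" if k: "k \<in> set_pmf p" for k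
  proof (rule ccontr)
    assume "\<not> k \<le> 1"
    then obtain m where m: "k = Suc (Suc m)" by (metis One_nat_def Suc_le_mono le0 not0_implies_Suc)
    have "0 \<le> ?f (Suc m)" by (rule nonneg)
    \<comment> \<open>The recursion exhibits the gap in Bernoulli's inequality: the square makes it
      strict from two children on, since \<open>q < 1\<close>.\<close>
    moreover have "?f k = q * ?f (Suc m) + real (Suc m) * (q - 1)^2"
      by (simp add: m algebra_simps power2_eq_square)
    moreover have "0 < real (Suc m) * (q - 1)^2" using q by simp
    ultimately have "0 < ?f k" using q by (metis add_nonneg_pos mult_nonneg_nonneg)
    then show False using zero[OF k] by simp
  qed
  \<comment> \<open>Now \<open>1 - k\<close> is nonnegative with mean 0, so there is almost surely
    exactly one child, against \<open>pmf_0_pos\<close>.\<close>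
  have "(\<integral>k. 1 - real k \<partial>p) = 0" using integrable_real mean_one by simp
  moreover have "AE k in p. 0 \<le> 1 - real k" using le1 by (auto simp: AE_measure_pmf_iff)
  moreover have "integrable p (\<lambda>k. 1 - real k)" using integrable_real by simp
  ultimately have "AE k in p. 1 - real k = 0" using integral_nonneg_eq_0_iff_AE by blast
  moreover have "0 \<in> set_pmf p" using pmf_0_pos by (simp add: set_pmf_iff)
  ultimately show False by (auto simp: AE_measure_pmf_iff)
qed

text \<open>Generation \<open>Suc n\<close> of a tree is made of the generations \<open>n\<close> of
  the subtrees below its root. As each subtree has total weight 1, passing to the next generation
  multiplies the mean by the mean offspring number, which is 1.\<close>

lemma marked_weight_eq_1:
  assumes W: "total_weight = 1"
  shows "(\<integral>\<^sup>+(t, a). weight p t \<partial>count_space (marked_trees n)) = 1"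
proof -
  \<comment> \<open>\<open>Z n t\<close> is the size of generation \<open>n\<close> of
    \<open>t\<close>, written as an integral so that it splits along the lists of addresses and
    combines with Fubini.\<close>
  define Z where "Z n t = (\<integral>\<^sup>+a. indicator {a. valid t a \<and> length a = n} a \<partial>count_space UNIV)" for n t
  have Z0: "Z 0 t = 1" for t
    unfolding Z_def by (subst nn_integral_count_space_list) simp
  have Z_Suc: "Z (Suc n) (Node ts) = (\<Sum>t\<leftarrow>ts. Z n t)" for n ts
  proof -
    have "Z (Suc n) (Node ts) = (\<integral>\<^sup>+i. Z n (ts ! i) * indicator {..<length ts} i \<partial>count_space UNIV)"
    proof -
      have "indicator {a. valid (Node ts) a \<and> length a = Suc n} (i # xs) =
          indicator {a. valid (ts ! i) a \<and> length a = n} xs * (indicator {..<length ts} i :: ennreal)"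
        for i xs by (simp split: split_indicator)
      moreover have "indicator {a. valid (Node ts) a \<and> length a = Suc n} [] = (0 :: ennreal)"
        by simp
      ultimately show ?thesis
        unfolding Z_def
        by (subst nn_integral_count_space_list) (simp only: add_0_left nn_integral_multc
            measurable_count_space_eq1 Pi_UNIV UNIV_I space_borel)
    qed
    also have "\<dots> = (\<Sum>i<length ts. Z n (ts ! i))"
      by (subst nn_integral_count_space_indicator[symmetric])
        (auto simp: nn_integral_count_space_finite)
    finally show ?thesis by (simp add: sum.list_conv_set_nth lessThan_atLeast0)
  qed
  have "(\<integral>\<^sup>+t. weight p t * Z n t \<partial>count_space UNIV) = 1" for n
  proof (induction n)
    case 0
    then show ?case using W by (simp add: Z0)
  next
    case (Suc n)
    have "(\<integral>\<^sup>+t. weight p t * Z (Suc n) t \<partial>count_space UNIV) =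
        (\<integral>\<^sup>+ts. ennreal (pmf p (length ts)) * ((\<Prod>t\<leftarrow>ts. weight p t) * (\<Sum>t\<leftarrow>ts. Z n t)) \<partial>count_space UNIV)"
      by (subst nn_integral_ptree) (simp add: Z_Suc mult.assoc)
    also have "\<dots> = (\<integral>\<^sup>+k. ennreal (pmf p k) * of_nat k \<partial>count_space UNIV)"
      by (simp add: nn_integral_by_length[where h = "\<lambda>k. ennreal (pmf p k)"]
          nn_integral_lists_prod_sum[OF W] Suc)
    finally show ?case by (simp add: nn_mean_one)
  qed
  moreover have "(\<integral>\<^sup>+(t, a). weight p t \<partial>count_space (marked_trees n)) =
      (\<integral>\<^sup>+t. weight p t * Z n t \<partial>count_space UNIV)"
  proof -
    have "(\<integral>\<^sup>+(t, a). weight p t \<partial>count_space (marked_trees n)) =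
        (\<integral>\<^sup>+(t, a). weight p t * indicator {a. valid t a \<and> length a = n} a \<partial>count_space UNIV)"
      by (subst nn_integral_count_space_indicator)
        (auto intro!: nn_integral_cong simp: marked_trees_def split: split_indicator)
    then show ?thesis
      unfolding Z_def by (simp add: nn_integral_fst_count_space[symmetric] nn_integral_cmult)
  qed
  ultimately show ?thesis by simp
qed

end

section \<open>Plane trees in the record graph\<close>

fun tree_size :: "ptree \<Rightarrow> nat" where
  "tree_size (Node ts) = Suc (\<Sum>t\<leftarrow>ts. tree_size t)"

\<comment> \<open>The index of a vertex in the depth-first order that visits the last child first.\<close>
primrec offset :: "ptree \<Rightarrow> nat list \<Rightarrow> nat" where
  "offset t [] = 0"
| "offset t (i # p) = Suc ((\<Sum>j = Suc i..<length (subtrees t). tree_size (subtrees t ! j)) +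
     offset (subtrees t ! i) p)"

text \<open>Vertex \<open>p\<close> is placed at \<open>m - offset t p\<close>. The increment
  immediately to the left of a position is the one that sets its number of children, whence the
  shift by one.\<close>

definition window :: "(int \<Rightarrow> int) \<Rightarrow> int \<Rightarrow> ptree \<Rightarrow> bool" where
  "window x m t \<longleftrightarrow> (\<forall>p. valid t p \<longrightarrow> x (m - int (offset t p) - 1) = int (arity t p) - 1)"

lemma tree_size_eq: "tree_size t = Suc (\<Sum>i<length (subtrees t). tree_size (subtrees t ! i))"
  by (cases t) (simp add: sum.list_conv_set_nth lessThan_atLeast0)

lemma offset_append: "offset t (p @ q) = offset t p + offset (subtree_at t p) q"
  by (induction p arbitrary: t) auto

lemma offset_less_tree_size: "valid t p \<Longrightarrow> offset t p < tree_size t"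
proof (induction p arbitrary: t)
  case Nil
  then show ?case by (subst tree_size_eq) simp
next
  case (Cons i p)
  let ?n = "length (subtrees t)" and ?s = "\<lambda>j. tree_size (subtrees t ! j)"
  have i: "i < ?n" and "offset (subtrees t ! i) p < ?s i" using Cons by auto
  moreover have "(\<Sum>j\<in>{i..<?n}. ?s j) \<le> (\<Sum>j<?n. ?s j)" by (rule sum_mono2) auto
  moreover have "(\<Sum>j\<in>{i..<?n}. ?s j) = ?s i + (\<Sum>j\<in>{Suc i..<?n}. ?s j)"
    by (rule sum.atLeast_Suc_lessThan[OF i])
  ultimately show ?case by (subst tree_size_eq) simp
qed

text \<open>The subtrees of different children fill disjoint ranges of indices, later siblings
  first. Distinct vertices therefore read distinct increments.\<close>

lemma offset_inj: "valid t p \<Longrightarrow> valid t q \<Longrightarrow> offset t p = offset t q \<Longrightarrow> p = q"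
proof (induction p arbitrary: t q)
  case Nil
  then show ?case by (cases q) auto
next
  case (Cons i p)
  let ?n = "length (subtrees t)" and ?s = "\<lambda>j. tree_size (subtrees t ! j)"
  obtain j q' where q: "q = j # q'" using Cons.prems by (cases q) auto
  have less: "offset t (j # q') < offset t (i # p)"
    if "i < j" "j < ?n" "valid (subtrees t ! j) q'" for i j p q'
  proof -
    have "(\<Sum>l\<in>{j..<?n}. ?s l) \<le> (\<Sum>l\<in>{Suc i..<?n}. ?s l)"
      using that by (intro sum_mono2) auto
    moreover have "(\<Sum>l\<in>{j..<?n}. ?s l) = ?s j + (\<Sum>l\<in>{Suc j..<?n}. ?s l)"
      by (rule sum.atLeast_Suc_lessThan) (use that in simp)
    moreover have "offset (subtrees t ! j) q' < ?s j"
      using that by (intro offset_less_tree_size)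
    ultimately show ?thesis by simp
  qed
  have "i = j"
    using less[of i j q' p] less[of j i p q'] Cons.prems q by (cases i j rule: linorder_cases) auto
  then show ?case using Cons q by auto
qed

lemma valid_Node: "{p. valid (Node ts) p} = insert [] (\<Union>i<length ts. (#) i ` {p. valid (ts ! i) p})"
proof (intro equalityI subsetI)
  fix p assume "p \<in> {p. valid (Node ts) p}"
  then show "p \<in> insert [] (\<Union>i<length ts. (#) i ` {p. valid (ts ! i) p})" by (cases p) auto
qed auto

lemma finite_valid: "finite {p. valid t p}"
proof (induction t)
  case (Node ts)
  then show ?case unfolding valid_Node by auto
qed

lemma weight_eq_prod: "weight \<pi> t = (\<Prod>p | valid t p. ennreal (pmf \<pi> (arity t p)))"
proof (induction t)
  case (Node ts)
  let ?f = "\<lambda>p. ennreal (pmf \<pi> (arity (Node ts) p))"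
  have "(\<Prod>p\<in>(\<Union>i<length ts. (#) i ` {p. valid (ts ! i) p}). ?f p) =
      (\<Prod>i<length ts. \<Prod>p\<in>(#) i ` {p. valid (ts ! i) p}. ?f p)"
    by (rule prod.UNION_disjoint) (auto simp: finite_valid)
  also have "\<dots> = (\<Prod>i<length ts. weight \<pi> (ts ! i))"
    by (intro prod.cong refl) (simp add: Node prod.reindex)
  finally have *: "(\<Prod>p\<in>(\<Union>i<length ts. (#) i ` {p. valid (ts ! i) p}). ?f p) = \<dots>" .
  have "(\<Prod>p | valid (Node ts) p. ?f p) =
      ?f [] * (\<Prod>p\<in>(\<Union>i<length ts. (#) i ` {p. valid (ts ! i) p}). ?f p)"
    unfolding valid_Node by (rule prod.insert) (auto simp: finite_valid)
  then show ?case using * by (simp add: weight_Node del: weight.simps)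
qed

lemma sum_interval_split:
  fixes x :: "int \<Rightarrow> int"
  assumes "a \<le> b" "b \<le> c"
  shows "(\<Sum>l=a..<c. x l) = (\<Sum>l=a..<b. x l) + (\<Sum>l=b..<c. x l)"
  using assms by (subst sum.union_disjoint[symmetric]) (auto intro!: sum.cong)

text \<open>Here \<open>k\<close> is the number of children of position \<open>m\<close>, and
  \<open>{e i..<e (Suc i)}\<close> carries the increments of the subtree whose top, child number
  \<open>i\<close>, sits at \<open>e (Suc i)\<close>. Read from right to left, each block is a
  Lukasiewicz path: the sums stay nonnegative until the left end, where they reach -1.\<close>

context
  fixes x :: "int \<Rightarrow> int" and m :: int and k :: nat and e :: "nat \<Rightarrow> int"
  assumes top: "x (m - 1) = int k - 1" and e_top: "e k = m - 1"
    and e_less: "\<And>i. i < k \<Longrightarrow> e i < e (Suc i)"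
    and block: "\<And>i. i < k \<Longrightarrow> (\<Sum>l=e i..<e (Suc i). x l) = - 1"
    and block_nonneg: "\<And>i j. i < k \<Longrightarrow> e i < j \<Longrightarrow> j \<le> e (Suc i) \<Longrightarrow> 0 \<le> (\<Sum>l=j..<e (Suc i). x l)"
begin

lemma blocks_mono: "i \<le> j \<Longrightarrow> j \<le> k \<Longrightarrow> e i \<le> e j"
proof (induction j)
  case (Suc j)
  then show ?case using e_less[of j] by (cases "i = Suc j") auto
qed simp

lemma blocks_strict_mono: "i < j \<Longrightarrow> j \<le> k \<Longrightarrow> e i < e j"
  using e_less[of i] blocks_mono[of "Suc i" j] by auto

lemma blocks_less: "i \<le> k \<Longrightarrow> e i < m"
  using blocks_mono[of i k] e_top by auto

lemma sum_at_block: "i \<le> k \<Longrightarrow> (\<Sum>l=e i..<m. x l) = int i - 1"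
proof (induction i rule: inc_induct)
  case base
  have "{e k..<m} = {m - 1}" using e_top by auto
  then show ?case using top by simp
next
  case (step i)
  have "(\<Sum>l=e i..<m. x l) = (\<Sum>l=e i..<e (Suc i). x l) + (\<Sum>l=e (Suc i)..<m. x l)"
    using e_less[of i] blocks_less[of "Suc i"] step by (intro sum_interval_split) auto
  then show ?case using step block[of i] by simp
qed

lemma sum_in_block:
  assumes "i < k" "e i < j" "j \<le> e (Suc i)"
  shows "int i \<le> (\<Sum>l=j..<m. x l)"
proof -
  have "(\<Sum>l=j..<m. x l) = (\<Sum>l=j..<e (Suc i). x l) + (\<Sum>l=e (Suc i)..<m. x l)"
    using assms blocks_less[of "Suc i"] by (intro sum_interval_split) auto
  then show ?thesis using block_nonneg[OF assms] sum_at_block[of "Suc i"] assms by simp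
qed

lemma block_of:
  assumes "e i < j" "j < m" "i \<le> k"
  shows "\<exists>n\<ge>i. n < k \<and> e n < j \<and> j \<le> e (Suc n)"
proof -
  define n where "n = Max {n. n \<le> k \<and> e n < j}"
  have fin: "finite {n. n \<le> k \<and> e n < j}" by (rule finite_subset[of _ "{..k}"]) auto
  then have "n \<in> {n. n \<le> k \<and> e n < j}" unfolding n_def by (rule Max_in) (use assms in auto)
  moreover have "i \<le> n" unfolding n_def by (rule Max_ge[OF fin]) (use assms in auto)
  moreover have "n \<noteq> k" using calculation assms e_top by auto
  moreover have "j \<le> e (Suc n)"
  proof (rule ccontr)
    assume "\<not> j \<le> e (Suc n)"
    then have "Suc n \<le> n"
      unfolding n_def using calculation by (intro Max_ge[OF fin]) (auto simp: n_def)
    then show False by simp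
  qed
  ultimately show ?thesis by (intro exI[of _ n]) auto
qed

text \<open>Let \<open>S u\<close> be the sum over \<open>{u..<m}\<close>. A child of
  \<open>m\<close> is a \<open>u\<close> with \<open>S u\<close> nonnegative and below
  \<open>S j\<close> for every \<open>j\<close> strictly between \<open>u\<close> and
  \<open>m\<close>: a new strict minimum, seen from right to left. Since
  \<open>S (e i) = i - 1\<close> and \<open>S\<close> is at least \<open>i\<close> inside block
  \<open>i\<close>, the new minima are \<open>e k\<close>, ..., \<open>e 1\<close> at the levels
  \<open>k - 1\<close>, ..., 0. At \<open>e 0\<close> the level is -1, so no position from there
  leftwards can be a child.\<close>

lemma record_graph_children_blocks: "{u. (u, m) \<in> record_graph x} = (\<lambda>i. e (Suc i)) ` {..<k}"
proof (intro equalityI subsetI)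
  fix u assume "u \<in> {u. (u, m) \<in> record_graph x}"
  then have u: "u < m" "0 \<le> (\<Sum>l=u..<m. x l)" "\<And>j. u < j \<Longrightarrow> j < m \<Longrightarrow> (\<Sum>l=u..<j. x l) < 0"
    by (auto simp: record_graph_iff)
  have low: "(\<Sum>l=u..<m. x l) < (\<Sum>l=j..<m. x l)" if "u < j" "j < m" for j
    using u(3)[of j] that sum_interval_split[of u j m x] by simp
  have "e 0 < u"
  proof (rule ccontr)
    assume "\<not> e 0 < u"
    then show False
      using low[of "e 0"] sum_at_block[of 0] u(2) blocks_less[of 0] by (cases "u = e 0") auto
  qed
  then obtain n where n: "n < k" "e n < u" "u \<le> e (Suc n)" using block_of[of 0 u] u by auto
  have "u = e (Suc n)"
  proof (rule ccontr)
    assume "u \<noteq> e (Suc n)"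
    then have "(\<Sum>l=u..<m. x l) < int n"
      using low[of "e (Suc n)"] n blocks_less[of "Suc n"] sum_at_block[of "Suc n"] by simp
    then show False using sum_in_block[OF n] by simp
  qed
  then show "u \<in> (\<lambda>i. e (Suc i)) ` {..<k}" using n by auto
next
  fix u assume "u \<in> (\<lambda>i. e (Suc i)) ` {..<k}"
  then obtain i where i: "i < k" "u = e (Suc i)" by auto
  have "(\<Sum>l=u..<j. x l) < 0" if j: "u < j" "j < m" for j
  proof -
    obtain n where n: "Suc i \<le> n" "n < k" "e n < j" "j \<le> e (Suc n)"
      using block_of[of "Suc i" j] i j by auto
    then have "int (Suc i) \<le> (\<Sum>l=j..<m. x l)" using sum_in_block[of n j] by simp
    then show ?thesis using sum_interval_split[of u j m x] j sum_at_block[of "Suc i"] i by simp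
  qed
  then show "u \<in> {u. (u, m) \<in> record_graph x}"
    using i sum_at_block[of "Suc i"] blocks_less[of "Suc i"] by (simp add: record_graph_iff)
qed

end

section \<open>Windows realise plane trees in the record graph\<close>

abbreviation block_start :: "int \<Rightarrow> ptree \<Rightarrow> nat \<Rightarrow> int" where
  "block_start m t i \<equiv> m - 1 - (\<Sum>j = i..<length (subtrees t). int (tree_size (subtrees t ! j)))"

lemma offset_child: "m - int (offset t [i]) = block_start m t (Suc i)"
  by simp

lemma block_start_diff:
  assumes "i < length (subtrees t)"
  shows "block_start m t i = block_start m t (Suc i) - int (tree_size (subtrees t ! i))"
  by (simp add: sum.atLeast_Suc_lessThan[OF assms])

lemma tree_size_pos: "0 < tree_size t"
  by (cases t) simp

lemma window_subtree: "window x m t \<Longrightarrow> valid t p \<Longrightarrow> window x (m - int (offset t p)) (subtree_at t p)"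
  unfolding window_def
proof (intro allI impI)
  fix q
  assume w: "\<forall>q. valid t q \<longrightarrow> x (m - int (offset t q) - 1) = int (arity t q) - 1"
    and p: "valid t p" and q: "valid (subtree_at t p) q"
  have "x (m - int (offset t (p @ q)) - 1) = int (arity t (p @ q)) - 1"
    using w p q by (simp add: valid_append)
  then show "x (m - int (offset t p) - int (offset (subtree_at t p) q) - 1) =
      int (arity (subtree_at t p) q) - 1"
    by (simp add: offset_append subtree_at_append algebra_simps)
qed

text \<open>The blocks of the root are the windows of its subtrees, so the block lemmas apply
  inductively. The base point \<open>m\<close> stays arbitrary because each subtree has its
  own.\<close>

lemma window_sums:
  "window x m t \<Longrightarrow> (\<Sum>l = m - int (tree_size t)..<m. x l) = - 1 \<and>
    (\<forall>j. m - int (tree_size t) < j \<and> j \<le> m \<longrightarrow> 0 \<le> (\<Sum>l = j..<m. x l))"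
proof (induction t arbitrary: m)
  case (Node ts)
  let ?k = "length ts" and ?e = "block_start m (Node ts)"
  have IH: "(\<Sum>l = ?e i..<?e (Suc i). x l) = - 1 \<and>
      (\<forall>j. ?e i < j \<and> j \<le> ?e (Suc i) \<longrightarrow> 0 \<le> (\<Sum>l = j..<?e (Suc i). x l))" if i: "i < ?k" for i
  proof -
    have "window x (?e (Suc i)) (ts ! i)"
      using window_subtree[OF Node.prems, of "[i]"] i unfolding offset_child by simp
    moreover have "ts ! i \<in> set ts" using i by simp
    moreover have d: "?e i = ?e (Suc i) - int (tree_size (ts ! i))"
      using block_start_diff[of i "Node ts" m] i by simp
    ultimately show ?thesis unfolding d by (intro Node.IH)
  qed
  have top: "x (m - 1) = int ?k - 1" using Node.prems[unfolded window_def, rule_format, of "[]"] by simp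
  have less: "?e i < ?e (Suc i)" if "i < ?k" for i
    using block_start_diff[of i "Node ts" m] tree_size_pos[of "ts ! i"] that by simp
  \<comment> \<open>The open slot is \<open>?e ?k = m - 1\<close>, an empty sum that is left to the
    simplifier.\<close>
  note prem = top _ less IH[THEN conjunct1] IH[THEN conjunct2, rule_format, OF _ conjI]
  have e0: "?e 0 = m - int (tree_size (Node ts))"
    by (simp add: tree_size_eq[of "Node ts"] lessThan_atLeast0 del: tree_size.simps)
  have "(\<Sum>l = ?e 0..<m. x l) = - 1" by (subst sum_at_block[of x m ?k ?e, OF prem]) auto
  moreover have "0 \<le> (\<Sum>l = j..<m. x l)" if j: "?e 0 < j" "j \<le> m" for j
  proof (cases "j = m")
    case False
    then obtain n where "n < ?k" "?e n < j" "j \<le> ?e (Suc n)"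
      using block_of[of x m ?k ?e 0 j, OF prem] j by auto
    then show ?thesis using sum_in_block[of x m ?k ?e n j, OF prem] by simp
  qed simp
  ultimately show ?case unfolding e0 by blast
qed

text \<open>Every vertex heads a window of its own, so the block criterion yields its children.
  Increments outside the window have no influence, because the level -1 at the left end of each
  window screens off everything further left.\<close>

lemma window_embeds:
  assumes "window x m t"
  shows "embeds (record_graph x) {(i, j). i < j} (\<lambda>p. m - int (offset t p)) t"
  unfolding embeds_def
proof (intro allI impI)
  fix p assume p: "valid t p"
  define s where "s = subtree_at t p"
  define n where "n = m - int (offset t p)"
  let ?k = "length (subtrees s)" and ?e = "block_start n s"
  have w: "window x n s" using window_subtree[OF assms p] by (simp add: s_def n_def)
  have child: "m - int (offset t (p @ [i])) = ?e (Suc i)" for i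
    by (simp add: offset_append s_def n_def)
  have blk: "(\<Sum>l = ?e i..<?e (Suc i). x l) = - 1 \<and>
      (\<forall>j. ?e i < j \<and> j \<le> ?e (Suc i) \<longrightarrow> 0 \<le> (\<Sum>l = j..<?e (Suc i). x l))" if i: "i < ?k" for i
  proof -
    have "window x (?e (Suc i)) (subtrees s ! i)"
      using window_subtree[OF w, of "[i]"] i unfolding offset_child by simp
    then show ?thesis unfolding block_start_diff[OF i] by (rule window_sums)
  qed
  have top: "x (n - 1) = int ?k - 1" using w[unfolded window_def, rule_format, of "[]"] by simp
  have less: "?e i < ?e (Suc i)" if "i < ?k" for i
    using block_start_diff[OF that, of n] tree_size_pos[of "subtrees s ! i"] by simp
  note prem = top _ less blk[THEN conjunct1] blk[THEN conjunct2, rule_format, OF _ conjI]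
  have "{u. (u, n) \<in> record_graph x} = (\<lambda>i. ?e (Suc i)) ` {..<?k}"
    by (subst record_graph_children_blocks[of x n ?k ?e, OF prem]) auto
  moreover have "?e (Suc i) < ?e (Suc j) \<longleftrightarrow> i < j" if "i < ?k" "j < ?k" for i j
    using blocks_strict_mono[of x n ?k ?e "Suc i" "Suc j", OF prem]
      blocks_strict_mono[of x n ?k ?e "Suc j" "Suc i", OF prem] that
    by (cases i j rule: linorder_cases) auto
  ultimately show "{u. (u, m - int (offset t p)) \<in> record_graph x} =
        (\<lambda>i. m - int (offset t (p @ [i]))) ` {..<arity t p} \<and>
      (\<forall>i<arity t p. \<forall>j<arity t p.
        (m - int (offset t (p @ [i])), m - int (offset t (p @ [j]))) \<in> {(i, j). i < j} \<longleftrightarrow> i < j)"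
    unfolding child by (simp add: s_def n_def)
qed

lemma (in prob_space) prob_window:
  fixes X :: "int \<Rightarrow> 'a \<Rightarrow> int"
  assumes indep: "indep_vars (\<lambda>_. count_space UNIV) X UNIV"
    and law: "\<And>n k. prob {\<omega> \<in> space M. X n \<omega> = int k - 1} = pmf \<pi> k"
  shows "{\<omega> \<in> space M. window (\<lambda>n. X n \<omega>) m t} \<in> events"
    and "emeasure M {\<omega> \<in> space M. window (\<lambda>n. X n \<omega>) m t} = weight \<pi> t"
proof -
  let ?V = "{p. valid t p}"
  define g where "g p = m - int (offset t p) - 1" for p
  \<comment> \<open>The independent events are indexed by positions, so the vertex is recovered from
    its position; this is legitimate because offsets are injective.\<close>
  define A where "A j = {int (arity t (inv_into ?V g j)) - 1}" for j
  have inj: "inj_on g ?V" by (auto simp: inj_on_def g_def intro: offset_inj)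
  have A: "A (g p) = {int (arity t p) - 1}" if "valid t p" for p
    using inj that by (simp add: A_def)
  have X: "X n \<in> M \<rightarrow>\<^sub>M count_space UNIV" for n using indep by (auto simp: indep_vars_def)
  have ev: "X j -` B \<inter> space M \<in> events" for j B by (rule measurable_sets[OF X]) simp
  have ne: "?V \<noteq> {}" by (auto intro: exI[of _ "[]"])
  have eq: "{\<omega> \<in> space M. window (\<lambda>n. X n \<omega>) m t} = (\<Inter>j\<in>g ` ?V. X j -` A j \<inter> space M)"
    using ne A by (auto simp: window_def g_def)
  show "{\<omega> \<in> space M. window (\<lambda>n. X n \<omega>) m t} \<in> events"
    unfolding eq using ne ev by (intro sets.finite_INT) (auto simp: finite_valid)
  have "prob (\<Inter>j\<in>g ` ?V. X j -` A j \<inter> space M) = (\<Prod>j\<in>g ` ?V. prob (X j -` A j \<inter> space M))"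
    using ne by (intro indep_varsD[OF indep]) (auto simp: finite_valid)
  also have "\<dots> = (\<Prod>p\<in>?V. pmf \<pi> (arity t p))"
  proof (subst prod.reindex[OF inj], rule prod.cong)
    fix p assume "p \<in> ?V"
    then have "X (g p) -` A (g p) \<inter> space M = {\<omega> \<in> space M. X (g p) \<omega> = int (arity t p) - 1}"
      using A by auto
    then show "((\<lambda>j. prob (X j -` A j \<inter> space M)) \<circ> g) p = pmf \<pi> (arity t p)"
      using law by simp
  qed simp
  finally show "emeasure M {\<omega> \<in> space M. window (\<lambda>n. X n \<omega>) m t} = weight \<pi> t"
    unfolding eq by (simp add: emeasure_eq_measure weight_eq_prod prod_ennreal)
qed

section \<open>Plane trees in the Galton--Watson tree\<close>

text \<open>Addresses in a plane tree count children in their order, whereas labels number them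
  independently of the order. The entry \<open>\<omega> v ! i\<close> translates one into the
  other.\<close>

primrec follow :: "(label \<Rightarrow> nat list) \<Rightarrow> label \<Rightarrow> nat list \<Rightarrow> label" where
  "follow \<omega> v [] = v"
| "follow \<omega> v (i # p) = follow \<omega> (child v (\<omega> v ! i)) p"

text \<open>A permutation is demanded, not merely a length, so that the listed children are
  distinct; other lists have probability zero.\<close>

definition grows :: "(label \<Rightarrow> nat list) \<Rightarrow> label \<Rightarrow> ptree \<Rightarrow> bool" where
  "grows \<omega> v t \<longleftrightarrow> (\<forall>p. valid t p \<longrightarrow> \<omega> (follow \<omega> v p) \<in> permutations_of_set {..<arity t p})"

abbreviation gw_arcs :: "(label \<Rightarrow> nat list) \<Rightarrow> (label \<times> label) set" where
  "gw_arcs \<omega> \<equiv> {(child v i, v) | v i. i \<in> set (\<omega> v)}"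

abbreviation gw_order :: "(label \<Rightarrow> nat list) \<Rightarrow> (label \<times> label) set" where
  "gw_order \<omega> \<equiv> {(child v i, child v j) | v i j. precedes (\<omega> v) i j}"

definition level :: "label \<Rightarrow> int" where
  "level v = int (fst v) - int (length (snd v))"

lemma level_child: "level (child v i) = level v - 1"
  using child_cases[of v i] by (auto simp: level_def)

lemma follow_append: "follow \<omega> v (p @ q) = follow \<omega> (follow \<omega> v p) q"
  by (induction p arbitrary: v) auto

lemma grows_Node:
  "grows \<omega> v (Node ts) \<longleftrightarrow> \<omega> v \<in> permutations_of_set {..<length ts} \<and>
    (\<forall>i<length ts. grows \<omega> (child v (\<omega> v ! i)) (ts ! i))"
proof
  assume g: "grows \<omega> v (Node ts)"
  have "\<omega> v \<in> permutations_of_set {..<length ts}"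
    using g[unfolded grows_def, rule_format, of "[]"] by simp
  moreover have "grows \<omega> (child v (\<omega> v ! i)) (ts ! i)" if "i < length ts" for i
    unfolding grows_def
  proof (intro allI impI)
    fix p assume "valid (ts ! i) p"
    then show "\<omega> (follow \<omega> (child v (\<omega> v ! i)) p) \<in> permutations_of_set {..<arity (ts ! i) p}"
      using g[unfolded grows_def, rule_format, of "i # p"] that by simp
  qed
  ultimately show "\<omega> v \<in> permutations_of_set {..<length ts} \<and>
    (\<forall>i<length ts. grows \<omega> (child v (\<omega> v ! i)) (ts ! i))" by blast
next
  assume g: "\<omega> v \<in> permutations_of_set {..<length ts} \<and>
    (\<forall>i<length ts. grows \<omega> (child v (\<omega> v ! i)) (ts ! i))"
  show "grows \<omega> v (Node ts)"
    unfolding grows_def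
  proof (intro allI impI)
    fix p assume p: "valid (Node ts) p"
    show "\<omega> (follow \<omega> v p) \<in> permutations_of_set {..<arity (Node ts) p}"
    proof (cases p)
      case (Cons i q)
      then show ?thesis using g p by (simp add: grows_def)
    qed (use g in simp)
  qed
qed

lemma precedes_nth:
  "distinct xs \<Longrightarrow> i < length xs \<Longrightarrow> j < length xs \<Longrightarrow> precedes xs (xs ! i) (xs ! j) \<longleftrightarrow> i < j"
proof (induction xs arbitrary: i j)
  case (Cons x xs)
  then show ?case by (cases i; cases j) (auto simp: precedes_Cons precedes_irrefl)
qed simp

lemma grows_embeds:
  assumes "grows \<omega> v t"
  shows "embeds (gw_arcs \<omega>) (gw_order \<omega>) (follow \<omega> v) t"
  unfolding embeds_def
proof (intro allI impI)
  fix p assume p: "valid t p"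
  let ?u = "follow \<omega> v p"
  have u: "\<omega> ?u \<in> permutations_of_set {..<arity t p}" using assms p by (simp add: grows_def)
  then have set: "set (\<omega> ?u) = {..<arity t p}" and dist: "distinct (\<omega> ?u)"
    by (auto dest: permutations_of_setD)
  then have len: "length (\<omega> ?u) = arity t p" using distinct_card by fastforce
  have child: "follow \<omega> v (p @ [i]) = child ?u (\<omega> ?u ! i)" for i by (simp add: follow_append)
  have "{w. (w, ?u) \<in> gw_arcs \<omega>} = child ?u ` set (\<omega> ?u)" by blast
  also have "set (\<omega> ?u) = (!) (\<omega> ?u) ` {..<arity t p}"
    unfolding len[symmetric] by (auto simp: set_conv_nth)
  also have "child ?u ` \<dots> = (\<lambda>i. child ?u (\<omega> ?u ! i)) ` {..<arity t p}"
    by (rule image_image)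
  finally have "{w. (w, ?u) \<in> gw_arcs \<omega>} = (\<lambda>i. child ?u (\<omega> ?u ! i)) ` {..<arity t p}" .
  moreover have "(child ?u (\<omega> ?u ! i), child ?u (\<omega> ?u ! j)) \<in> gw_order \<omega> \<longleftrightarrow> i < j"
    if "i < arity t p" "j < arity t p" for i j
  proof -
    have "(child ?u (\<omega> ?u ! i), child ?u (\<omega> ?u ! j)) \<in> gw_order \<omega> \<longleftrightarrow>
        precedes (\<omega> ?u) (\<omega> ?u ! i) (\<omega> ?u ! j)"
      unfolding mem_Collect_eq prod.inject child_inject by blast
    then show ?thesis using precedes_nth[OF dist] that len by simp
  qed
  ultimately show "{w. (w, ?u) \<in> gw_arcs \<omega>} = (\<lambda>i. follow \<omega> v (p @ [i])) ` {..<arity t p} \<and>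
    (\<forall>i<arity t p. \<forall>j<arity t p.
      (follow \<omega> v (p @ [i]), follow \<omega> v (p @ [j])) \<in> gw_order \<omega> \<longleftrightarrow> i < j)"
    unfolding child by blast
qed

lemma grows_unique: "grows \<omega> v t \<Longrightarrow> grows \<omega> v t' \<Longrightarrow> t = t'"
  by (rule embeds_unique[OF grows_embeds grows_embeds]) auto

section \<open>Independence of disjoint parts\<close>

text \<open>These are all labels that descendants of \<open>v\<close> may carry, whatever the
  reproduction lists are. The cone of an ancestor contains the lower ancestors, its child 0 being
  the next one.\<close>

definition cone :: "label \<Rightarrow> label set" where
  "cone v = range (foldl child v)"

lemma cone_refl: "v \<in> cone v"
  unfolding cone_def by (rule range_eqI[of _ _ "[]"]) simp

lemma cone_child: "cone (child v i) \<subseteq> cone v"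
proof
  fix w assume "w \<in> cone (child v i)"
  then obtain js where "w = foldl child v (i # js)" by (auto simp: cone_def)
  then show "w \<in> cone v" unfolding cone_def by (rule range_eqI)
qed

lemma level_foldl: "level (foldl child v js) = level v - int (length js)"
  by (induction js arbitrary: v) (auto simp: level_child)

lemma not_in_cone_child: "v \<notin> cone (child v i)"
proof
  assume "v \<in> cone (child v i)"
  then obtain js where "v = foldl child (child v i) js" by (auto simp: cone_def)
  then have "level v = level v - 1 - int (length js)" by (metis level_foldl level_child)
  then show False by simp
qed

text \<open>Each step lowers the level by one, so both paths have the same length; injectivity of
  \<open>child\<close> then traces the common endpoint back to a common start.\<close>

lemma foldl_child_inject:
  "foldl child u js = foldl child v ks \<Longrightarrow> level u = level v \<Longrightarrow> u = v"
proof (induction js arbitrary: ks rule: rev_induct)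
  case Nil
  then have "int (length ks) = 0" using level_foldl[of v ks] by simp
  then show ?case using Nil by simp
next
  case (snoc j js)
  have "int (length ks) = int (length js) + 1"
    using snoc.prems level_foldl[of v ks] level_foldl[of u "js @ [j]"] by simp
  then obtain k ks' where "ks = ks' @ [k]" by (cases ks rule: rev_cases) auto
  then show ?case using snoc by (simp add: child_inject)
qed

lemma disjoint_cones: "i \<noteq> j \<Longrightarrow> cone (child v i) \<inter> cone (child v j) = {}"
proof (rule ccontr)
  assume "i \<noteq> j" "cone (child v i) \<inter> cone (child v j) \<noteq> {}"
  then obtain w where "w \<in> cone (child v i)" "w \<in> cone (child v j)" by blast
  then obtain js ks where "w = foldl child (child v i) js" "w = foldl child (child v j) ks"
    unfolding cone_def by blast
  then have "foldl child (child v i) js = foldl child (child v j) ks" by simp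
  then have "child v i = child v j" by (rule foldl_child_inject) (simp add: level_child)
  then show False using \<open>i \<noteq> j\<close> by (simp add: child_inject)
qed

text \<open>A pointwise substitute for measurability with respect to the coordinates in
  \<open>K\<close>. An implication suffices because the two points can be exchanged.\<close>

definition depends_on :: "'i set \<Rightarrow> ('i \<Rightarrow> 'b) set \<Rightarrow> bool" where
  "depends_on K A \<longleftrightarrow> (\<forall>\<omega> \<omega>'. (\<forall>u\<in>K. \<omega> u = \<omega>' u) \<longrightarrow> \<omega> \<in> A \<longrightarrow> \<omega>' \<in> A)"

lemma depends_onD: "depends_on K A \<Longrightarrow> (\<And>u. u \<in> K \<Longrightarrow> \<omega> u = \<omega>' u) \<Longrightarrow> \<omega> \<in> A \<longleftrightarrow> \<omega>' \<in> A"
  unfolding depends_on_def by metis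

text \<open>An event depending on \<open>K j\<close> is the preimage, under restriction to
  \<open>K j\<close>, of a measurable set; restrictions to disjoint sets of coordinates are
  independent.\<close>

lemma measure_PiM_Inter_disjoint:
  fixes N :: "'i \<Rightarrow> 'b measure" and A :: "'j \<Rightarrow> ('i \<Rightarrow> 'b) set"
  assumes N: "\<And>i. prob_space (N i)" and space: "\<And>i. space (N i) = UNIV"
    and J: "finite J" and K: "disjoint_family_on K J"
    and A: "\<And>j. j \<in> J \<Longrightarrow> A j \<in> sets (PiM UNIV N)" "\<And>j. j \<in> J \<Longrightarrow> depends_on (K j) (A j)"
  shows "measure (PiM UNIV N) (\<Inter>j\<in>J. A j) = (\<Prod>j\<in>J. measure (PiM UNIV N) (A j))"
proof -
  interpret P: prob_space "PiM UNIV N" using N by (rule prob_space_PiM)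
  have spaceP: "space (PiM UNIV N) = UNIV" by (simp add: space_PiM space PiE_UNIV_domain)
  have ext: "\<omega> \<in> A j \<longleftrightarrow> \<omega>' \<in> A j" if "j \<in> J" "\<And>u. u \<in> K j \<Longrightarrow> \<omega> u = \<omega>' u" for j \<omega> \<omega>'
    using A(2)[OF that(1)] that(2) by (rule depends_onD)
  have indep: "P.indep_vars N (\<lambda>i \<omega>. \<omega> i) UNIV"
    by (subst P.indep_vars_iff_distr_eq_PiM') (auto simp: distr_PiM_component N restrict_UNIV)
  \<comment> \<open>An arbitrary filling of the coordinates outside \<open>K j\<close>. Any value is
    admissible since each factor has space \<open>UNIV\<close>.\<close>
  define c :: "'i \<Rightarrow> 'b" where "c = (\<lambda>_. undefined)"
  define e where "e j g = (\<lambda>u. if u \<in> K j then g u else c u)" for j and g :: "'i \<Rightarrow> 'b"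
  have e: "e j \<in> PiM (K j) N \<rightarrow>\<^sub>M PiM UNIV N" for j
    unfolding e_def
  proof (rule measurable_abs_UNIV)
    fix u show "(\<lambda>g. if u \<in> K j then g u else c u) \<in> PiM (K j) N \<rightarrow>\<^sub>M N u"
      by (cases "u \<in> K j") (auto simp: space)
  qed
  define B where "B j = e j -` A j \<inter> space (PiM (K j) N)" for j
  have B: "B j \<in> sets (PiM (K j) N)" if "j \<in> J" for j
    unfolding B_def using e A(1)[OF that] by (rule measurable_sets)
  have AB: "(\<lambda>\<omega>. restrict \<omega> (K j)) -` B j \<inter> space (PiM UNIV N) = A j" if "j \<in> J" for j
  proof -
    have "restrict \<omega> (K j) \<in> B j \<longleftrightarrow> \<omega> \<in> A j" for \<omega>
    proof -
      have "e j (restrict \<omega> (K j)) \<in> A j \<longleftrightarrow> \<omega> \<in> A j" by (rule ext[OF that]) (simp add: e_def)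
      then show ?thesis by (simp add: B_def space_PiM space PiE_def)
    qed
    then show ?thesis by (auto simp: spaceP)
  qed
  show ?thesis
  proof (cases "J = {}")
    case True
    then show ?thesis using P.prob_space spaceP by simp
  next
    case False
    have "P.indep_vars (\<lambda>j. PiM (K j) N) (\<lambda>j \<omega>. restrict \<omega> (K j)) J"
      using P.indep_vars_restrict[OF indep _ K] by simp
    then have "P.prob (\<Inter>j\<in>J. (\<lambda>\<omega>. restrict \<omega> (K j)) -` B j \<inter> space (PiM UNIV N)) =
        (\<Prod>j\<in>J. P.prob ((\<lambda>\<omega>. restrict \<omega> (K j)) -` B j \<inter> space (PiM UNIV N)))"
      using False J B by (intro P.indep_varsD) auto
    then show ?thesis using AB by (simp cong: INF_cong prod.cong)
  qed
qed

section \<open>Probabilities of plane trees in the Galton--Watson tree\<close>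

text \<open>The list determines \<open>k\<close>, so a single number of children contributes, and
  its mass is shared equally by \<open>k!\<close> arrangements.\<close>

lemma pmf_reproduction:
  assumes "xs \<in> permutations_of_set {..<k}"
  shows "pmf (reproduction q) xs = pmf q k / fact k"
proof -
  have iff: "xs \<in> permutations_of_set {..<n} \<longleftrightarrow> n = k" for n
    using assms by (auto simp: permutations_of_set_def)
  have "pmf (reproduction q) xs = (\<integral>n. indicator {k} n / fact k \<partial>q)"
    unfolding reproduction_def pmf_bind
    by (intro Bochner_Integration.integral_cong refl)
      (auto simp: pmf_of_set permutations_of_set_empty_iff iff indicator_def)
  then show ?thesis by (simp add: measure_pmf_single)
qed

text \<open>Deleting the entry at position \<open>i\<close> leaves an arbitrary arrangement of
  \<open>A - {x}\<close>. The count is needed for the arrangements that put the spine at a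
  prescribed position among its siblings.\<close>

lemma card_permutations_fixed_entry:
  assumes "finite A" "x \<in> A" "i < card A"
  shows "card {xs \<in> permutations_of_set A. xs ! i = x} = fact (card A - 1)"
proof -
  let ?ins = "\<lambda>ys. take i ys @ x # drop i ys"
  let ?del = "\<lambda>xs. take i xs @ drop (Suc i) xs"
  have "bij_betw ?ins (permutations_of_set (A - {x})) {xs \<in> permutations_of_set A. xs ! i = x}"
  proof (rule bij_betw_byWitness[where f' = ?del])
    have len: "length ys = card A - 1" if "ys \<in> permutations_of_set (A - {x})" for ys
      using that length_finite_permutations_of_set assms by fastforce
    have len': "length xs = card A" if "xs \<in> permutations_of_set A" for xs
      using that length_finite_permutations_of_set by blast
    show "\<forall>ys\<in>permutations_of_set (A - {x}). ?del (?ins ys) = ys"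
      using len assms by (auto simp: min_def)
    show "\<forall>xs\<in>{xs \<in> permutations_of_set A. xs ! i = x}. ?ins (?del xs) = xs"
      using len' assms by (auto simp: min_def id_take_nth_drop[symmetric])
    show "?ins ` permutations_of_set (A - {x}) \<subseteq> {xs \<in> permutations_of_set A. xs ! i = x}"
    proof (rule image_subsetI)
      fix ys assume ys: "ys \<in> permutations_of_set (A - {x})"
      then have "set ys = A - {x}" "distinct ys" by (auto dest: permutations_of_setD)
      moreover have "set ys = set (take i ys) \<union> set (drop i ys)"
        by (metis append_take_drop_id set_append)
      ultimately have "set (?ins ys) = A" "distinct (?ins ys)"
        using assms set_take_disj_set_drop_if_distinct[of ys i i] by auto
      then show "?ins ys \<in> {xs \<in> permutations_of_set A. xs ! i = x}"
        using len[OF ys] assms by (auto simp: permutations_of_set_def nth_append)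
    qed
    show "?del ` {xs \<in> permutations_of_set A. xs ! i = x} \<subseteq> permutations_of_set (A - {x})"
    proof (rule image_subsetI)
      fix xs assume xs: "xs \<in> {xs \<in> permutations_of_set A. xs ! i = x}"
      then have "xs = take i xs @ x # drop (Suc i) xs"
        using len' assms by (auto simp: id_take_nth_drop[symmetric])
      moreover have "set xs = A" "distinct xs" using xs by (auto dest: permutations_of_setD)
      ultimately have "distinct (take i xs @ x # drop (Suc i) xs)"
        "set (take i xs @ x # drop (Suc i) xs) = A" by metis+
      then have "distinct (?del xs)" "set (?del xs) = A - {x}" by auto
      then show "?del xs \<in> permutations_of_set (A - {x})" by (simp add: permutations_of_set_def)
    qed
  qed
  then have "card (permutations_of_set (A - {x})) = card {xs \<in> permutations_of_set A. xs ! i = x}"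
    by (rule bij_betw_same_card)
  then show ?thesis using assms by simp
qed

section \<open>The branching property and the weight of a descendant tree\<close>

context critical_offspring
begin

definition gw_space :: "(label \<Rightarrow> nat list) measure" where
  "gw_space = PiM UNIV (\<lambda>v. measure_pmf (reproduction_at p v))"

lemma prob_space_gw_space: "prob_space gw_space"
  unfolding gw_space_def by (rule prob_space_PiM) (rule measure_pmf.prob_space_axioms)

lemma space_gw_space: "space gw_space = UNIV"
  by (simp add: gw_space_def space_PiM PiE_UNIV_domain)

lemma measurable_gw_component [measurable]: "(\<lambda>\<omega>. \<omega> v) \<in> gw_space \<rightarrow>\<^sub>M count_space UNIV"
proof -
  have "(\<lambda>\<omega>. \<omega> v) \<in> gw_space \<rightarrow>\<^sub>M measure_pmf (reproduction_at p v)"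
    unfolding gw_space_def by (rule measurable_component_singleton) simp
  then show ?thesis by (simp cong: measurable_cong_sets)
qed

lemma emeasure_gw_component:
  "emeasure gw_space {\<omega>. \<omega> v = xs} = ennreal (pmf (reproduction_at p v) xs)"
proof -
  have "emeasure (measure_pmf (reproduction_at p v)) {xs} =
      emeasure (distr gw_space (measure_pmf (reproduction_at p v)) (\<lambda>\<omega>. \<omega> v)) {xs}"
    unfolding gw_space_def by (subst distr_PiM_component) (auto intro: measure_pmf.prob_space_axioms)
  also have "\<dots> = emeasure gw_space ((\<lambda>\<omega>. \<omega> v) -` {xs} \<inter> space gw_space)"
    by (rule emeasure_distr) (auto cong: measurable_cong_sets)
  finally show ?thesis by (simp add: vimage_def space_gw_space emeasure_pmf_single)
qed

text \<open>Once the list at \<open>v\<close> is fixed, so are the labels of the children; their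
  cones are pairwise disjoint and avoid \<open>v\<close>, which makes the conditions on the subtrees
  and on the list independent.\<close>

lemma branching_single:
  fixes B :: "nat \<Rightarrow> (label \<Rightarrow> nat list) set"
  assumes xs: "distinct xs" "length xs = k"
    and B: "\<And>i. i < k \<Longrightarrow> B i \<in> sets gw_space"
      "\<And>i. i < k \<Longrightarrow> depends_on (cone (child v (xs ! i))) (B i)"
      "\<And>i. i < k \<Longrightarrow> emeasure gw_space (B i) = w i"
  defines "D \<equiv> {\<omega>. \<omega> v = xs \<and> (\<forall>i<k. \<omega> \<in> B i)}"
  shows "D \<in> sets gw_space" "depends_on (cone v) D"
    "emeasure gw_space D = ennreal (pmf (reproduction_at p v) xs) * (\<Prod>i<k. w i)"
proof -
  interpret P: prob_space gw_space by (rule prob_space_gw_space)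
  \<comment> \<open>The extra index \<open>k\<close> stands for the condition at \<open>v\<close>
    itself.\<close>
  define C where "C j = (if j < k then B j else {\<omega>. \<omega> v = xs})" for j
  define K where "K j = (if j < k then cone (child v (xs ! j)) else {v})" for j
  have single: "{\<omega>. \<omega> v = xs} \<in> sets gw_space"
    using measurable_sets[OF measurable_gw_component, of "{xs}" v]
    by (simp add: vimage_def space_gw_space)
  have C_sets: "C j \<in> sets gw_space" for j
    using B(1)[of j] single by (simp add: C_def)
  have C_depends: "depends_on (K j) (C j)" for j
    using B(2)[of j] by (auto simp: C_def K_def depends_on_def)
  have "{..<Suc k} = insert k {..<k}" by auto
  then have D: "D = (\<Inter>j\<in>{..<Suc k}. C j)"
    by (auto simp: D_def C_def simp del: lessThan_Suc)
  show "D \<in> sets gw_space"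
    unfolding D by (rule sets.finite_INT) (use C_sets in auto)
  have Ksub: "K j \<subseteq> cone v" for j
    using cone_child[of v "xs ! j"] cone_refl[of v] by (simp add: K_def)
  show "depends_on (cone v) D"
    unfolding depends_on_def
  proof (intro allI impI)
    fix \<omega> \<omega>' :: "label \<Rightarrow> nat list"
    assume eq: "\<forall>u\<in>cone v. \<omega> u = \<omega>' u" and \<omega>: "\<omega> \<in> D"
    have "\<omega> \<in> C j \<longleftrightarrow> \<omega>' \<in> C j" for j
      by (rule depends_onD[OF C_depends[of j]]) (use eq Ksub[of j] in auto)
    then show "\<omega>' \<in> D" using \<omega> unfolding D by simp
  qed
  have "disjoint_family_on K {..<Suc k}"
    unfolding disjoint_family_on_def
  proof (intro ballI impI)
    fix i j assume "i \<in> {..<Suc k}" "j \<in> {..<Suc k}" "i \<noteq> j"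
    then show "K i \<inter> K j = {}"
      using disjoint_cones[of "xs ! i" "xs ! j" v] not_in_cone_child[of v] xs
      by (auto simp: K_def nth_eq_iff_index_eq)
  qed
  then have "measure gw_space (\<Inter>j\<in>{..<Suc k}. C j) = (\<Prod>j<Suc k. measure gw_space (C j))"
    unfolding gw_space_def using C_sets C_depends
    by (intro measure_PiM_Inter_disjoint[where K = K])
      (auto simp: gw_space_def intro: measure_pmf.prob_space_axioms)
  then have "emeasure gw_space D = (\<Prod>j<Suc k. emeasure gw_space (C j))"
    unfolding D by (simp add: P.emeasure_eq_measure prod_ennreal del: prod.lessThan_Suc)
  also have "\<dots> = (\<Prod>j<k. w j) * emeasure gw_space {\<omega>. \<omega> v = xs}"
    using B(3) by (simp add: C_def)
  finally show "emeasure gw_space D = ennreal (pmf (reproduction_at p v) xs) * (\<Prod>i<k. w i)"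
    by (simp add: emeasure_gw_component mult.commute)
qed

text \<open>The labels of the children vary with the list at \<open>v\<close>, so \<open>B\<close>
  takes the label as an argument and the event is split by lists. The set \<open>S\<close> allows
  the list to be constrained at an ancestor; the probabilities \<open>w i\<close> must be the same
  for all lists in \<open>S\<close>.\<close>

lemma branching:
  fixes B :: "nat \<Rightarrow> label \<Rightarrow> (label \<Rightarrow> nat list) set"
  assumes S: "S \<subseteq> permutations_of_set {..<k}"
    and B: "\<And>xs i. xs \<in> S \<Longrightarrow> i < k \<Longrightarrow> B i (child v (xs ! i)) \<in> sets gw_space"
      "\<And>xs i. xs \<in> S \<Longrightarrow> i < k \<Longrightarrow> depends_on (cone (child v (xs ! i))) (B i (child v (xs ! i)))"
      "\<And>xs i. xs \<in> S \<Longrightarrow> i < k \<Longrightarrow> emeasure gw_space (B i (child v (xs ! i))) = w i"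
  defines "A \<equiv> {\<omega>. \<omega> v \<in> S \<and> (\<forall>i<k. \<omega> \<in> B i (child v (\<omega> v ! i)))}"
  shows "A \<in> sets gw_space" "depends_on (cone v) A"
    "emeasure gw_space A = (\<Sum>xs\<in>S. ennreal (pmf (reproduction_at p v) xs)) * (\<Prod>i<k. w i)"
proof -
  define D where "D xs = {\<omega>. \<omega> v = xs \<and> (\<forall>i<k. \<omega> \<in> B i (child v (xs ! i)))}" for xs
  have finS: "finite S" using S by (rule finite_subset) simp
  have A: "A = (\<Union>xs\<in>S. D xs)" by (auto simp: A_def D_def)
  have perm: "distinct xs" "length xs = k" if "xs \<in> S" for xs
    using that S length_finite_permutations_of_set[of xs "{..<k}"]
    by (auto dest: permutations_of_setD)
  note D = branching_single[OF perm B, folded D_def]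
  show "A \<in> sets gw_space" unfolding A using finS D(1) by (intro sets.finite_UN) auto
  show "depends_on (cone v) A" using D(2) unfolding A depends_on_def by blast
  have "disjoint_family_on D S" by (auto simp: disjoint_family_on_def D_def)
  then have "emeasure gw_space A = (\<Sum>xs\<in>S. emeasure gw_space (D xs))"
    unfolding A using D(1) finS by (intro sum_emeasure[symmetric]) auto
  also have "\<dots> = (\<Sum>xs\<in>S. ennreal (pmf (reproduction_at p v) xs) * (\<Prod>i<k. w i))"
    by (rule sum.cong) (auto intro: D(3))
  finally show "emeasure gw_space A = (\<Sum>xs\<in>S. ennreal (pmf (reproduction_at p v) xs)) * (\<Prod>i<k. w i)"
    by (simp only: sum_distrib_right)
qed

text \<open>Away from the proper ancestors the \<open>k!\<close> arrangements cancel the factor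
  \<open>1 / k!\<close>, so the numbering of children leaves no trace in the law. The induction
  stays away from the ancestors, because only an ancestor has an ancestor as a child.\<close>

lemma grows_event:
  assumes "\<not> (0 < fst v \<and> snd v = [])"
  shows "{\<omega>. grows \<omega> v t} \<in> sets gw_space" "depends_on (cone v) {\<omega>. grows \<omega> v t}"
    "emeasure gw_space {\<omega>. grows \<omega> v t} = weight p t"
proof -
  have "{\<omega>. grows \<omega> v t} \<in> sets gw_space \<and> depends_on (cone v) {\<omega>. grows \<omega> v t} \<and>
    emeasure gw_space {\<omega>. grows \<omega> v t} = weight p t"
    using assms
  proof (induction t arbitrary: v)
    case (Node ts)
    let ?k = "length ts" and ?B = "\<lambda>i u. {\<omega>. grows \<omega> u (ts ! i)}"
    have nonspine: "\<not> (0 < fst (child v i) \<and> snd (child v i) = [])" for i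
      using child_cases[of v i] Node.prems by auto
    have B: "?B i (child v (xs ! i)) \<in> sets gw_space"
      "depends_on (cone (child v (xs ! i))) (?B i (child v (xs ! i)))"
      "emeasure gw_space (?B i (child v (xs ! i))) = weight p (ts ! i)"
      if "i < ?k" for xs :: "nat list" and i
      using Node.IH[OF nth_mem[OF that] nonspine] by blast+
    note * = branching[of "permutations_of_set {..<?k}" ?k ?B v, OF subset_refl B]
    have "(\<Sum>xs\<in>permutations_of_set {..<?k}. ennreal (pmf (reproduction_at p v) xs)) =
        (\<Sum>xs\<in>permutations_of_set {..<?k}. ennreal (pmf p ?k / fact ?k))"
      using Node.prems by (intro sum.cong refl) (auto simp: reproduction_at_def pmf_reproduction)
    also have "\<dots> = ennreal (pmf p ?k)"
      by (simp add: ennreal_of_nat_eq_real_of_nat ennreal_mult[symmetric] del: of_nat_fact) simp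
    finally show ?case using * by (simp add: grows_Node weight_Node del: weight.simps)
  qed
  then show "{\<omega>. grows \<omega> v t} \<in> sets gw_space" "depends_on (cone v) {\<omega>. grows \<omega> v t}"
    "emeasure gw_space {\<omega>. grows \<omega> v t} = weight p t" by blast+
qed

text \<open>The fixed-point equation also admits an infinite value. It is excluded by reading the
  weights as probabilities of disjoint events, the possible descendant trees of the root.\<close>

lemma total_weight_le_1: "total_weight \<le> 1"
proof -
  interpret P: prob_space gw_space by (rule prob_space_gw_space)
  have "total_weight = (\<integral>\<^sup>+t. emeasure gw_space {\<omega>. grows \<omega> (0, []) t} \<partial>count_space UNIV)"
    by (simp add: grows_event)
  also have "\<dots> = emeasure gw_space (\<Union>t. {\<omega>. grows \<omega> (0, []) t})"
    by (rule emeasure_UN_countable[symmetric])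
      (auto simp: grows_event disjoint_family_on_def dest: grows_unique)
  also have "\<dots> \<le> 1" by (rule P.emeasure_le_1)
  finally show ?thesis .
qed

lemma total_weight_1: "total_weight = 1"
  by (rule total_weight_eq_1[OF total_weight_le_1])

lemma pmf_size_biased: "pmf (size_biased p) k = real k * pmf p k"
  unfolding size_biased_def
proof (rule pmf_embed_pmf)
  show "(\<integral>\<^sup>+k. ennreal (real k * pmf p k) \<partial>count_space UNIV) = 1"
    using nn_mean_one by (simp add: ennreal_mult ennreal_of_nat_eq_real_of_nat mult.commute)
qed simp

text \<open>By induction along \<open>a\<close>, from the ancestor at the top down to the root. The
  event is built from independent pieces to have exactly the stated probability; inclusion in the
  event of interest is all that is claimed.\<close>

lemma spine_event:
  assumes "valid t a"
  shows "\<exists>A\<in>sets gw_space. depends_on (cone (length a, [])) A \<and> emeasure gw_space A = weight p t \<and>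
    (\<forall>\<omega>\<in>A. grows \<omega> (length a, []) t \<and> follow \<omega> (length a, []) a = (0, []))"
  using assms
proof (induction a arbitrary: t)
  case Nil
  then show ?case using grows_event[of "(0, [])" t] by (intro bexI[of _ "{\<omega>. grows \<omega> (0, []) t}"]) auto
next
  case (Cons i a)
  obtain ts where t: "t = Node ts" by (cases t)
  let ?k = "length ts" and ?v = "(Suc (length a), []) :: label"
  have i: "i < ?k" and "valid (ts ! i) a" using Cons.prems t by auto
  then obtain A' where A': "A' \<in> sets gw_space" "depends_on (cone (length a, [])) A'"
    "emeasure gw_space A' = weight p (ts ! i)"
    "\<forall>\<omega>\<in>A'. grows \<omega> (length a, []) (ts ! i) \<and> follow \<omega> (length a, []) a = (0, [])"
    using Cons.IH by blast
  \<comment> \<open>Child 0 of an ancestor continues the spine, so these lists put the next ancestor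
    at position \<open>i\<close>. There the event of the induction hypothesis is imposed; the other
    subtrees lie off the spine.\<close>
  define S where "S = {xs \<in> permutations_of_set {..<?k}. xs ! i = 0}"
  define B where "B j u = (if j = i then A' else {\<omega>. grows \<omega> u (ts ! j)})" for j u
  have S: "S \<subseteq> permutations_of_set {..<?k}" by (auto simp: S_def)
  have B: "B j (child ?v (xs ! j)) \<in> sets gw_space \<and>
      depends_on (cone (child ?v (xs ! j))) (B j (child ?v (xs ! j))) \<and>
      emeasure gw_space (B j (child ?v (xs ! j))) = weight p (ts ! j)"
    if xs: "xs \<in> S" and j: "j < ?k" for xs j
  proof (cases "j = i")
    case True
    then show ?thesis using xs A' by (simp add: B_def S_def)
  next
    case False
    have "distinct xs" "length xs = ?k"
      using xs S length_finite_permutations_of_set[of xs "{..<?k}"] by (auto dest: permutations_of_setD)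
    then have "xs ! j \<noteq> 0"
      using nth_eq_iff_index_eq[of xs j i] False i j xs by (simp add: S_def)
    then have "\<not> (0 < fst (child ?v (xs ! j)) \<and> snd (child ?v (xs ! j)) = [])"
      using child_cases[of ?v "xs ! j"] by auto
    then show ?thesis using False by (simp add: B_def grows_event)
  qed
  define A where "A = {\<omega>. \<omega> ?v \<in> S \<and> (\<forall>j<?k. \<omega> \<in> B j (child ?v (\<omega> ?v ! j)))}"
  note * = branching[of S ?k B ?v "\<lambda>j. weight p (ts ! j)", folded A_def, OF S
      B[THEN conjunct1] B[THEN conjunct2, THEN conjunct1] B[THEN conjunct2, THEN conjunct2]]
  \<comment> \<open>Size bias gives \<open>k * pmf p k\<close>, each arrangement has the share
    \<open>1 / k!\<close>, and \<open>(k - 1)!\<close> of them lie in \<open>S\<close>: the product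
    is \<open>pmf p k\<close>.\<close>
  have "(\<Sum>xs\<in>S. ennreal (pmf (reproduction_at p ?v) xs)) =
      (\<Sum>xs\<in>S. ennreal (real ?k * pmf p ?k / fact ?k))"
    using S by (intro sum.cong refl) (auto simp: reproduction_at_def pmf_reproduction pmf_size_biased)
  also have "\<dots> = of_nat (fact (?k - 1)) * ennreal (real ?k * pmf p ?k / fact ?k)"
  proof -
    have "0 \<in> {..<?k}" using i by auto
    then have "card S = fact (?k - 1)"
      unfolding S_def using card_permutations_fixed_entry[of "{..<?k}" 0 i] i by simp
    then show ?thesis by simp
  qed
  also have "\<dots> = ennreal (real (fact (?k - 1)) * (real ?k * pmf p ?k / fact ?k))"
    by (simp only: ennreal_of_nat_eq_real_of_nat) (rule ennreal_mult[symmetric], auto)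
  also have "real (fact (?k - 1)) * (real ?k * pmf p ?k / fact ?k) = pmf p ?k"
  proof -
    obtain m where "?k = Suc m" using i by (cases ?k) auto
    then show ?thesis by (simp add: divide_simps)
  qed
  finally have "emeasure gw_space A = weight p t" using *(3) by (simp add: t weight_Node del: weight.simps)
  moreover have "grows \<omega> ?v t \<and> follow \<omega> ?v (i # a) = (0, [])" if \<omega>: "\<omega> \<in> A" for \<omega>
  proof -
    have v: "\<omega> ?v \<in> S" "\<And>j. j < ?k \<Longrightarrow> \<omega> \<in> B j (child ?v (\<omega> ?v ! j))" using \<omega> by (auto simp: A_def)
    have c: "child ?v (\<omega> ?v ! i) = (length a, [])" using v(1) by (simp add: S_def)
    have "grows \<omega> (length a, []) (ts ! i)" "follow \<omega> (length a, []) a = (0, [])"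
      using v(2)[OF i] A'(4) by (auto simp: B_def)
    moreover have "grows \<omega> (child ?v (\<omega> ?v ! j)) (ts ! j)" if "j < ?k" for j
      using v(2)[OF that] c calculation by (cases "j = i") (auto simp: B_def)
    moreover have "\<omega> ?v \<in> permutations_of_set {..<?k}" using v(1) S by blast
    ultimately show ?thesis unfolding t grows_Node using c by simp
  qed
  ultimately show ?case using *(1,2) by auto
qed

end

section \<open>The law of a ball around the root\<close>

text \<open>Equal depth of the marked vertex \<open>r\<close> makes both tops the same ancestor of
  \<open>r\<close>. The tree hanging there is unique, and so is the address of \<open>r\<close> in
  it.\<close>

lemma marked_embedding_unique:
  fixes h :: "'v \<Rightarrow> int"
  assumes sv: "single_valued E" and h: "\<And>u v. (u, v) \<in> E \<Longrightarrow> h u < h v"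
    and f: "embeds E L f t" "valid t a" "f a = r" and f': "embeds E L f' t'" "valid t' a'" "f' a' = r"
    and len: "length a = length a'"
  shows "t = t'" "a = a'"
proof -
  have root: "f [] = f' []"
    using embeds_root_eq[OF sv f(1) f'(1) f(2) f'(2) _ len] f(3) f'(3) by simp
  then show t: "t = t'" by (rule embeds_unique[OF f(1) f'(1)])
  have "f a' = r" using embeds_determined[OF f(1) f'(1) root] f'(2,3) t by simp
  then show "a = a'" using embeds_inj[of E h, OF sv h f(1) f(2)] f(3) f'(2) t by simp
qed

text \<open>Membership in the component is a countable union over path lengths, and paths are
  extended through countably many vertices.\<close>

lemma measurable_iso_class_component:
  fixes E L :: "'a \<Rightarrow> ('v::countable \<times> 'v) set"
  assumes ft: "\<And>\<omega>. ordered_family_tree (component (E \<omega>) (L \<omega>) r)"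
    and E [measurable]: "\<And>u v. Measurable.pred M (\<lambda>\<omega>. (u, v) \<in> E \<omega>)"
    and L: "\<And>u v. Measurable.pred M (\<lambda>\<omega>. (u, v) \<in> L \<omega>)"
  shows "(\<lambda>\<omega>. iso_class (component (E \<omega>) (L \<omega>) r)) \<in> M \<rightarrow>\<^sub>M borel"
proof -
  have sel: "verts (component E' L' r) = {w. (r, w) \<in> (E' \<union> E'\<inverse>)\<^sup>*}"
    "arcs (component E' L' r) = Restr E' {w. (r, w) \<in> (E' \<union> E'\<inverse>)\<^sup>*}"
    "sib_order (component E' L' r) = L'" "root_vertex (component E' L' r) = r"
    for E' L' :: "('v \<times> 'v) set"
    by (simp_all add: component_def Let_def)
  have [measurable]: "Measurable.pred M (\<lambda>\<omega>. (r, w) \<in> (E \<omega> \<union> (E \<omega>)\<inverse>) ^^ n)" for w n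
  proof (induction n arbitrary: w)
    case (Suc n)
    have [measurable]: "Measurable.pred M (\<lambda>\<omega>. (r, w) \<in> (E \<omega> \<union> (E \<omega>)\<inverse>) ^^ n)" for w
      by (rule Suc)
    have "(\<lambda>\<omega>. (r, w) \<in> (E \<omega> \<union> (E \<omega>)\<inverse>) ^^ Suc n) =
        (\<lambda>\<omega>. \<exists>u. (r, u) \<in> (E \<omega> \<union> (E \<omega>)\<inverse>) ^^ n \<and> ((u, w) \<in> E \<omega> \<or> (w, u) \<in> E \<omega>))"
      by (auto simp: fun_eq_iff)
    then show ?case by simp
  qed simp
  then have [measurable]: "Measurable.pred M (\<lambda>\<omega>. (r, w) \<in> (E \<omega> \<union> (E \<omega>)\<inverse>)\<^sup>*)" for w
    unfolding rtrancl_power by simp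
  show ?thesis
  proof (rule measurable_iso_class[where r = r])
    show "Measurable.pred M (\<lambda>\<omega>. v \<in> verts (component (E \<omega>) (L \<omega>) r))" for v
      unfolding sel mem_Collect_eq by simp
    show "Measurable.pred M (\<lambda>\<omega>. (u, v) \<in> arcs (component (E \<omega>) (L \<omega>) r))" for u v
      unfolding sel Int_iff mem_Sigma_iff mem_Collect_eq by simp
  qed (use ft L in \<open>simp_all add: sel\<close>)
qed

lemma emeasure_distr_agree_set:
  assumes "f \<in> M \<rightarrow>\<^sub>M borel"
  shows "emeasure (distr M borel f) (Collect (agree_upto n T)) =
    emeasure M {\<omega> \<in> space M. agree_upto n T (f \<omega>)}"
  using assms by (subst emeasure_distr) (auto simp: open_agree_set intro!: arg_cong[where f = "emeasure M"])

text \<open>The result mentions only \<open>p\<close>, \<open>n\<close> and \<open>F\<close>, not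
  the underlying probability space. Two random graphs that meet the assumptions thus give the same
  probability to every ball.\<close>

lemma (in critical_offspring) emeasure_ball:
  fixes E L :: "'a \<Rightarrow> ('v::countable \<times> 'v) set" and h :: "'v \<Rightarrow> int" and F :: "nat rooted_graph"
  assumes M: "prob_space M"
    and ft: "\<And>\<omega>. ordered_family_tree (component (E \<omega>) (L \<omega>) r)"
    and meas: "(\<lambda>\<omega>. iso_class (component (E \<omega>) (L \<omega>) r)) \<in> M \<rightarrow>\<^sub>M borel"
    and sv: "\<And>\<omega>. single_valued (E \<omega>)" and h: "\<And>\<omega> u v. (u, v) \<in> E \<omega> \<Longrightarrow> h u < h v"
    and ev: "\<And>t a. valid t a \<Longrightarrow> length a = n \<Longrightarrow> \<exists>A\<in>sets M. emeasure M A = weight p t \<and>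
      (\<forall>\<omega>\<in>A. \<exists>f. embeds (E \<omega>) (L \<omega>) f t \<and> f a = r)"
    and F: "ordered_family_tree F"
  defines "Q \<equiv> (\<lambda>(t, a). isomorphic (root_ball n F) (root_ball n (plane_tree_graph t a)))"
  shows "emeasure M {\<omega> \<in> space M. agree_upto n (iso_class F) (iso_class (component (E \<omega>) (L \<omega>) r))} =
    (\<integral>\<^sup>+(t, a). weight p t \<partial>count_space {c \<in> marked_trees n. Q c})"
proof -
  interpret prob_space M by (rule M)
  let ?N = "marked_trees n"
  define S where "S = {\<omega> \<in> space M. agree_upto n (iso_class F) (iso_class (component (E \<omega>) (L \<omega>) r))}"
  have "\<forall>c\<in>?N. \<exists>A. A \<in> sets M \<and> emeasure M A = weight p (fst c) \<and>
      (\<forall>\<omega>\<in>A. \<exists>f. embeds (E \<omega>) (L \<omega>) f (fst c) \<and> f (snd c) = r)"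
  proof
    fix c assume "c \<in> ?N"
    then have "valid (fst c) (snd c)" "length (snd c) = n" by (auto simp: marked_trees_def)
    then show "\<exists>A. A \<in> sets M \<and> emeasure M A = weight p (fst c) \<and>
      (\<forall>\<omega>\<in>A. \<exists>f. embeds (E \<omega>) (L \<omega>) f (fst c) \<and> f (snd c) = r)"
      using ev by blast
  qed
  then obtain A where A: "\<And>c. c \<in> ?N \<Longrightarrow> A c \<in> sets M"
    "\<And>c. c \<in> ?N \<Longrightarrow> emeasure M (A c) = weight p (fst c)"
    "\<And>c \<omega>. c \<in> ?N \<Longrightarrow> \<omega> \<in> A c \<Longrightarrow> \<exists>f. embeds (E \<omega>) (L \<omega>) f (fst c) \<and> f (snd c) = r"
    by (metis (no_types, lifting) bchoice)
  have unique: "c = d" if cd: "c \<in> ?N" "d \<in> ?N" "\<omega> \<in> A c" "\<omega> \<in> A d" for c d \<omega>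
  proof -
    obtain f g where "embeds (E \<omega>) (L \<omega>) f (fst c)" "f (snd c) = r"
      "embeds (E \<omega>) (L \<omega>) g (fst d)" "g (snd d) = r"
      using A(3)[OF cd(1,3)] A(3)[OF cd(2,4)] by blast
    then show ?thesis
      using marked_embedding_unique[of "E \<omega>" h "L \<omega>" f "fst c" "snd c" r g "fst d" "snd d"] sv h cd(1,2)
      by (auto simp: marked_trees_def prod_eq_iff)
  qed
  have emeasure_UN: "emeasure M (\<Union>c\<in>N. A c) = (\<integral>\<^sup>+(t, a). weight p t \<partial>count_space N)"
    if N: "N \<subseteq> ?N" for N
  proof -
    have "disjoint_family_on A N"
      unfolding disjoint_family_on_def
    proof (intro ballI impI equals0I)
      fix c d \<omega> assume "c \<in> N" "d \<in> N" "c \<noteq> d" "\<omega> \<in> A c \<inter> A d"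
      then show False using unique[of c d \<omega>] N by blast
    qed
    then have "emeasure M (\<Union>c\<in>N. A c) = (\<integral>\<^sup>+c. emeasure M (A c) \<partial>count_space N)"
      using A(1) N by (intro emeasure_UN_countable) auto
    also have "\<dots> = (\<integral>\<^sup>+(t, a). weight p t \<partial>count_space N)"
      using A(2) N by (intro nn_integral_cong) auto
    finally show ?thesis .
  qed
  \<comment> \<open>On \<open>A c\<close> the ball of the component is the ball of the marked tree
    \<open>c\<close>, so the random condition reduces to the deterministic
    \<open>Q c\<close>.\<close>
  have agree: "\<omega> \<in> S \<longleftrightarrow> Q c" if c: "c \<in> ?N" "\<omega> \<in> A c" for c \<omega>
  proof -
    obtain t a where ta: "c = (t, a)" "valid t a" "length a = n" using c(1) by (auto simp: marked_trees_def)
    obtain f where f: "embeds (E \<omega>) (L \<omega>) f t" "f a = r" using A(3)[OF c] ta by auto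
    have iso: "isomorphic (root_ball n (plane_tree_graph t a)) (root_ball n (component (E \<omega>) (L \<omega>) r))"
      using ball_component_embedding[of "E \<omega>" h, OF sv h f(1) ta(2) f(2)] ta(3) by simp
    have "root_vertex (root_ball n (plane_tree_graph t a)) \<in> verts (root_ball n (plane_tree_graph t a))"
      using ta by (auto simp: root_ball_simps ball_verts_def plane_tree_graph_def intro!: exI[of _ 0])
    note iso' = isomorphic_sym[OF iso this]
    have "\<omega> \<in> space M" using A(1)[OF c(1)] c(2) sets.sets_into_space by blast
    then have "\<omega> \<in> S \<longleftrightarrow> isomorphic (root_ball n F) (root_ball n (component (E \<omega>) (L \<omega>) r))"
      by (simp add: S_def agree_upto_iso_class F ft)
    also have "\<dots> \<longleftrightarrow> Q c"
      using iso iso' by (auto simp: Q_def ta intro: isomorphic_trans)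
    finally show ?thesis .
  qed
  have "emeasure M (\<Union>c\<in>?N. A c) = 1"
    using emeasure_UN[of ?N] marked_weight_eq_1[OF total_weight_1] by simp
  then have "prob (\<Union>c\<in>?N. A c) = 1" by (simp add: emeasure_eq_measure)
  then have ae: "AE \<omega> in M. \<omega> \<in> (\<Union>c\<in>?N. A c)" by (rule AE_prob_1)
  have "emeasure M S = emeasure M (\<Union>c\<in>{c \<in> ?N. Q c}. A c)"
  proof (rule emeasure_eq_AE)
    show "AE \<omega> in M. \<omega> \<in> S \<longleftrightarrow> \<omega> \<in> (\<Union>c\<in>{c \<in> ?N. Q c}. A c)"
      using ae
    proof eventually_elim
      case (elim \<omega>)
      then obtain c where c: "c \<in> ?N" "\<omega> \<in> A c" by blast
      have "\<omega> \<in> (\<Union>c\<in>{c \<in> ?N. Q c}. A c) \<longleftrightarrow> Q c" using agree c by blast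
      then show ?case using agree[OF c] by simp
    qed
    have "Collect (agree_upto n (iso_class F)) \<in> sets borel" using open_agree_set by simp
    from measurable_sets[OF meas this] show "S \<in> sets M"
      unfolding S_def by (simp add: vimage_def Int_def conj_commute)
    show "(\<Union>c\<in>{c \<in> ?N. Q c}. A c) \<in> sets M" using A(1) by (intro sets.countable_UN') auto
  qed
  then show ?thesis using emeasure_UN[of "{c \<in> ?N. Q c}"] unfolding S_def by simp
qed

section \<open>The record tree and the Galton-Watson tree as instances\<close>

lemma measurable_record_tree:
  assumes X [measurable]: "\<And>n. X n \<in> M \<rightarrow>\<^sub>M count_space UNIV"
  shows "(\<lambda>\<omega>. iso_class (record_tree (\<lambda>n. X n \<omega>))) \<in> M \<rightarrow>\<^sub>M borel"
  unfolding record_tree_def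
proof (rule measurable_iso_class_component)
  show "ordered_family_tree (component (record_graph (\<lambda>n. X n \<omega>)) {(i, j). i < j} 0)" for \<omega>
    using ordered_family_tree_record_tree unfolding record_tree_def .
  have [measurable]: "(\<lambda>\<omega>. \<Sum>l\<in>I. X l \<omega>) \<in> M \<rightarrow>\<^sub>M count_space UNIV" if "finite I" for I
    using that
  proof induction
    case (insert l I)
    have "(\<lambda>\<omega>. X l \<omega> + (\<Sum>l\<in>I. X l \<omega>)) \<in> M \<rightarrow>\<^sub>M count_space UNIV"
      by (rule measurable_compose_countable[of "\<lambda>s \<omega>. X l \<omega> + s", OF _ insert.IH])
        (rule measurable_compose[OF X], simp)
    then show ?case using insert by simp
  qed simp
  have [measurable]: "Measurable.pred M (\<lambda>\<omega>. P (\<Sum>l\<in>I. X l \<omega>))" if "finite I" for I P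
    using measurable_compose[of "\<lambda>\<omega>. \<Sum>l\<in>I. X l \<omega>" M "count_space UNIV" P "count_space UNIV"] that
    by simp
  show "Measurable.pred M (\<lambda>\<omega>. (u, v) \<in> record_graph (\<lambda>n. X n \<omega>))" for u v
    unfolding record_graph_iff by simp
qed simp

context critical_offspring
begin

lemma measurable_galton_watson_tree:
  "(\<lambda>\<omega>. iso_class (galton_watson_tree \<omega>)) \<in> gw_space \<rightarrow>\<^sub>M borel"
  unfolding galton_watson_tree_def
proof (rule measurable_iso_class_component)
  show "ordered_family_tree (component (gw_arcs \<omega>) (gw_order \<omega>) (0, []))" for \<omega>
    using ordered_family_tree_galton_watson_tree unfolding galton_watson_tree_def .
  have P [measurable]: "Measurable.pred gw_space (\<lambda>\<omega>. P (\<omega> v))" for P v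
    by (rule measurable_compose[OF measurable_gw_component]) simp
  show "Measurable.pred gw_space (\<lambda>\<omega>. (u, v) \<in> gw_arcs \<omega>)" for u v
    unfolding mem_Collect_eq by measurable
  show "Measurable.pred gw_space (\<lambda>\<omega>. (u, v) \<in> gw_order \<omega>)" for u v
    unfolding mem_Collect_eq by measurable
qed

lemma emeasure_ball_galton_watson_tree:
  assumes F: "ordered_family_tree (F :: nat rooted_graph)"
  shows "emeasure gw_space {\<omega> \<in> space gw_space. agree_upto n (iso_class F) (iso_class (galton_watson_tree \<omega>))} =
    (\<integral>\<^sup>+(t, a). weight p t \<partial>count_space {c \<in> marked_trees n.
      (\<lambda>(t, a). isomorphic (root_ball n F) (root_ball n (plane_tree_graph t a))) c})"
  unfolding galton_watson_tree_def
proof (rule emeasure_ball[OF prob_space_gw_space _ _ _ _ _ F, where h = level])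
  show "ordered_family_tree (component (gw_arcs \<omega>) (gw_order \<omega>) (0, []))" for \<omega>
    using ordered_family_tree_galton_watson_tree unfolding galton_watson_tree_def .
  show "(\<lambda>\<omega>. iso_class (component (gw_arcs \<omega>) (gw_order \<omega>) (0, []))) \<in> gw_space \<rightarrow>\<^sub>M borel"
    using measurable_galton_watson_tree unfolding galton_watson_tree_def .
  show "single_valued (gw_arcs \<omega>)" for \<omega> by (auto simp: single_valued_def child_inject)
  show "level u < level v" if "(u, v) \<in> gw_arcs \<omega>" for \<omega> u v using that by (auto simp: level_child)
  show "\<exists>A\<in>sets gw_space. emeasure gw_space A = weight p t \<and>
      (\<forall>\<omega>\<in>A. \<exists>f. embeds (gw_arcs \<omega>) (gw_order \<omega>) f t \<and> f a = (0, []))" if "valid t a" for t a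
    using spine_event[OF that] grows_embeds by meson
qed

lemma emeasure_ball_record_tree:
  assumes M: "prob_space M" and indep: "prob_space.indep_vars M (\<lambda>_. count_space UNIV) X UNIV"
    and law: "\<And>n k. measure M {\<omega> \<in> space M. X n \<omega> = int k - 1} = pmf p k"
    and F: "ordered_family_tree (F :: nat rooted_graph)"
  shows "emeasure M {\<omega> \<in> space M. agree_upto n (iso_class F) (iso_class (record_tree (\<lambda>n. X n \<omega>)))} =
    (\<integral>\<^sup>+(t, a). weight p t \<partial>count_space {c \<in> marked_trees n.
      (\<lambda>(t, a). isomorphic (root_ball n F) (root_ball n (plane_tree_graph t a))) c})"
  unfolding record_tree_def
proof (rule emeasure_ball[OF M _ _ _ _ _ F, where h = id])
  interpret prob_space M by (rule M)
  show "ordered_family_tree (component (record_graph (\<lambda>n. X n \<omega>)) {(i, j). i < j} 0)" for \<omega>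
    using ordered_family_tree_record_tree unfolding record_tree_def .
  have "X n \<in> M \<rightarrow>\<^sub>M count_space UNIV" for n using indep by (auto simp: indep_vars_def)
  then show "(\<lambda>\<omega>. iso_class (component (record_graph (\<lambda>n. X n \<omega>)) {(i, j). i < j} 0)) \<in> M \<rightarrow>\<^sub>M borel"
    using measurable_record_tree[of X M] unfolding record_tree_def by simp
  show "single_valued (record_graph (\<lambda>n. X n \<omega>))" for \<omega>
    by (auto simp: single_valued_def record_graph_def)
  show "id u < id v" if "(u, v) \<in> record_graph (\<lambda>n. X n \<omega>)" for \<omega> u v
    using that by (simp add: record_graph_iff)
  fix t a
  \<comment> \<open>The top is put at \<open>offset t a\<close> so that the address \<open>a\<close>
    falls on position 0.\<close>
  let ?A = "{\<omega> \<in> space M. window (\<lambda>n. X n \<omega>) (int (offset t a)) t}"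
  have "\<exists>f. embeds (record_graph (\<lambda>n. X n \<omega>)) {(i, j). i < j} f t \<and> f a = 0" if "\<omega> \<in> ?A" for \<omega>
    using that window_embeds[of "\<lambda>n. X n \<omega>" "int (offset t a)" t] by fastforce
  then show "\<exists>A\<in>events. emeasure M A = weight p t \<and>
      (\<forall>\<omega>\<in>A. \<exists>f. embeds (record_graph (\<lambda>n. X n \<omega>)) {(i, j). i < j} f t \<and> f a = 0)"
    using prob_window[OF indep law] by blast
qed

end

section \<open>From the increments to the offspring distribution, and equality of the laws\<close>

lemma skip_free_offspring:
  fixes X :: "int \<Rightarrow> 'a \<Rightarrow> int"
  assumes X: "skip_free_increments M X"
    and mean: "(\<integral>\<omega>. real_of_int (X 0 \<omega>) \<partial>M) = 0"
    and \<pi>: "distr M (count_space UNIV) (\<lambda>\<omega>. X 0 \<omega> + 1) = measure_pmf (map_pmf int \<pi>)"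
  shows "critical_offspring \<pi>"
    and "measure M {\<omega> \<in> space M. X n \<omega> = int k - 1} = pmf \<pi> k"
proof -
  interpret prob_space M using X by (simp add: skip_free_increments_def)
  have rv: "X n \<in> M \<rightarrow>\<^sub>M count_space UNIV" for n
    using X by (auto simp: skip_free_increments_def indep_vars_def)
  then have rv1: "(\<lambda>\<omega>. X 0 \<omega> + 1) \<in> M \<rightarrow>\<^sub>M count_space UNIV"
    by (rule measurable_compose) simp
  have law: "measure M {\<omega> \<in> space M. X n \<omega> = int k - 1} = pmf \<pi> k" for n k
  proof -
    have "measure M {\<omega> \<in> space M. X n \<omega> = int k - 1} =
        measure (distr M (count_space UNIV) (X n)) {int k - 1}"
      using rv by (subst measure_distr) (auto intro!: arg_cong[where f = "measure M"])
    also have "distr M (count_space UNIV) (X n) = distr M (count_space UNIV) (X 0)"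
      using X unfolding skip_free_increments_def by blast
    also have "measure (distr M (count_space UNIV) (X 0)) {int k - 1} = measure M {\<omega> \<in> space M. X 0 \<omega> = int k - 1}"
      using rv by (subst measure_distr) (auto intro!: arg_cong[where f = "measure M"])
    also have "\<dots> = measure (distr M (count_space UNIV) (\<lambda>\<omega>. X 0 \<omega> + 1)) {int k}"
      using rv1 by (subst measure_distr) (auto intro!: arg_cong[where f = "measure M"])
    also have "\<dots> = pmf (map_pmf int \<pi>) (int k)" unfolding \<pi> by (rule measure_pmf_single)
    finally show ?thesis by (simp add: pmf_map_inj')
  qed
  then show "measure M {\<omega> \<in> space M. X n \<omega> = int k - 1} = pmf \<pi> k" .
  have int0: "integrable M (\<lambda>\<omega>. real_of_int (X 0 \<omega>))"
    using X by (simp add: skip_free_increments_def)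
  then have "integrable M (\<lambda>\<omega>. real_of_int (X 0 \<omega> + 1))" by simp
  then have "integrable (distr M (count_space UNIV) (\<lambda>\<omega>. X 0 \<omega> + 1)) real_of_int"
    using rv1 by (subst integrable_distr_eq) auto
  then have int: "integrable \<pi> real" unfolding \<pi> by simp
  have "measure_pmf.expectation (map_pmf int \<pi>) real_of_int = (\<integral>\<omega>. real_of_int (X 0 \<omega> + 1) \<partial>M)"
    unfolding \<pi>[symmetric] using rv1 by (subst integral_distr) auto
  also have "\<dots> = 1" using int0 mean by (simp add: prob_space)
  finally have "measure_pmf.expectation \<pi> real = 1" by simp
  \<comment> \<open>A step -1 is a vertex without children. Its positive probability excludes the
    law concentrated at one child, which also has mean 1 but produces no finite tree.\<close>
  moreover have "0 < pmf \<pi> 0"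
    using X law[of 0 0] by (simp add: skip_free_increments_def)
  ultimately show "critical_offspring \<pi>" using int by unfold_locales
qed

theorem theorem53:
  fixes M :: "'a measure" and X :: "int \<Rightarrow> 'a \<Rightarrow> int" and \<pi> :: "nat pmf"
  assumes "skip_free_increments M X"
    and "(\<integral>\<omega>. real_of_int (X 0 \<omega>) \<partial>M) = 0"
    and "distr M (count_space UNIV) (\<lambda>\<omega>. X 0 \<omega> + 1) = measure_pmf (map_pmf int \<pi>)"
  shows "(\<lambda>\<omega>. iso_class (record_tree (\<lambda>n. X n \<omega>))) \<in> M \<rightarrow>\<^sub>M borel \<and>
    distr M borel (\<lambda>\<omega>. iso_class (record_tree (\<lambda>n. X n \<omega>))) = EGWT \<pi>"
proof
  interpret critical_offspring \<pi> using skip_free_offspring(1)[OF assms] .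
  interpret M: prob_space M using assms(1) by (simp add: skip_free_increments_def)
  interpret gw: prob_space gw_space by (rule prob_space_gw_space)
  have indep: "M.indep_vars (\<lambda>_. count_space UNIV) X UNIV"
    using assms(1) by (simp add: skip_free_increments_def)
  then have "X n \<in> M \<rightarrow>\<^sub>M count_space UNIV" for n by (auto simp: M.indep_vars_def)
  then show meas: "(\<lambda>\<omega>. iso_class (record_tree (\<lambda>n. X n \<omega>))) \<in> M \<rightarrow>\<^sub>M borel"
    by (rule measurable_record_tree)
  have EGWT: "EGWT \<pi> = distr gw_space borel (\<lambda>\<omega>. iso_class (galton_watson_tree \<omega>))"
    by (simp add: EGWT_def gw_space_def)
  show "distr M borel (\<lambda>\<omega>. iso_class (record_tree (\<lambda>n. X n \<omega>))) = EGWT \<pi>"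
    unfolding EGWT
  proof (rule measure_eqI_rooted_tree)
    show "prob_space (distr M borel (\<lambda>\<omega>. iso_class (record_tree (\<lambda>n. X n \<omega>))))"
      using meas by (rule M.prob_space_distr)
    show "prob_space (distr gw_space borel (\<lambda>\<omega>. iso_class (galton_watson_tree \<omega>)))"
      using measurable_galton_watson_tree by (rule gw.prob_space_distr)
    fix r T
    obtain F :: "nat rooted_graph" where F: "ordered_family_tree F" "T = iso_class F"
      by (rule rooted_tree_cases)
    \<comment> \<open>The depth of the ancestor is taken equal to the radius \<open>r\<close>, so
      both sides become the same sum over marked trees.\<close>
    show "emeasure (distr M borel (\<lambda>\<omega>. iso_class (record_tree (\<lambda>n. X n \<omega>)))) (Collect (agree_upto r T)) =
        emeasure (distr gw_space borel (\<lambda>\<omega>. iso_class (galton_watson_tree \<omega>))) (Collect (agree_upto r T))"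
      using emeasure_ball_record_tree[OF M.prob_space_axioms indep skip_free_offspring(2)[OF assms] F(1), of r]
        emeasure_ball_galton_watson_tree[OF F(1), of r]
      by (simp add: emeasure_distr_agree_set meas measurable_galton_watson_tree F(2))
  qed simp_all
qed

end
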